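(* Let $\xi$ be a symmetric canonical element of $SO(2n+1)$ and let $m\le n$. If $N_\xi=\iota(G^{\mathbb R}_m(2n+1))$, then $$r_{\rho_k}(\xi)\le 2mk\quad\text{if } k\le n-m+1,$$ and $$r_{\rho_k}(\xi)\le 2m(n-m+1)+(k-n+m-1)(m+n-k)\quad\text{if } n>k>n-m+1.$$ In particular, for the standard representation $r_{\rho_1}(\xi)\le 2m$, and for the adjoint representation $r_{\rho_2}(\xi)\le 4m$ if $m<n$ and $r_{\rho_2}(\xi)\le 4m-2$ if $m=n$.
   Context: General setting. Let $G$ be a compact connected Lie group with Lie algebra $\mathfrak g$, $\mathfrak t\subset\mathfrak g$ a maximal torus (maximal abelian subalgebra), $\alpha_1,\ldots,\alpha_n\in\sqrt{-1}\,\mathfrak t^*$ the positive simple roots for a chosen set of positive roots $\Delta^+$, and $H_1,\ldots,H_n\in\mathfrak t$ the dual basis: $\alpha_i(H_j)=\sqrt{-1}\,\delta_{ij}$. Put $\mathfrak I(G)=\{\xi\in\mathfrak t:\exp_G(2\pi\xi)=e\}$, $\mathfrak I'(G)=\{\xi\in\mathfrak I(G): \alpha(\xi)/\sqrt{-1}\ge 0 \text{ for all }\alpha\in\Delta^+\}$ and $\mathfrak I^2(G)=\{\xi\in\mathfrak t:\exp_G(\pi\xi)=e\}$. For $\xi\in\mathfrak I'(G)$ let $\mathfrak g^\xi_j$ be the $\sqrt{-1}\,j$-eigenspace of $\mathrm{ad}\,\xi$ on $\mathfrak g^{\mathbb C}$ and $\mathfrak p_i^\xi=\bigoplus_{j\le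 i}\mathfrak g_j^\xi$. Define $\xi\preceq\xi'$ iff $\mathfrak p^\xi_i\subseteq\mathfrak p^{\xi'}_i$ for all $i\ge 0$ (writing $\xi=\sum n_iH_i$, $\xi'=\sum n_i'H_i$, this is equivalent to $n_i'\le n_i$ for all $i$), and $\xi\preceq_{\mathcal I}\xi'$ iff $\xi\preceq\xi'$ and $\xi-\xi'\in\mathfrak I^2(G)$. A symmetric canonical element of $G$ is a maximal element of $(\mathfrak I'(G),\preceq_{\mathcal I})$. For $\xi\in\mathfrak I'(G)$, $\gamma_\xi:S^1\to G$ is the homomorphism $\gamma_\xi(\lambda)=\exp_G(-\sqrt{-1}\ln(\lambda)\,\xi)$, so $\gamma_\xi(-1)=\exp_G(\pi\xi)$, and $N_\xi=\{g\gamma_\xi(-1)g^{-1}: g\in G\}$. Uniton number. If $\rho$ is an irreducible representation of $\mathfrak g^{\mathbb C}$ with highest weight $\omega^*$ and lowest weight $\varpi^*$, then $r_\rho(\xi):=\frac{1}{\sqrt{-1}}\big(\omega^*(\xi)-\varpi^*(\xi)\big)$. The case $(B_n)$, $G=SO(2n+1)$, acting on $\mathbb C^{2n+1}=(\mathbb R^{2n+1})^{\mathbb C}$. Fix a basis $e_1,\ldots,e_{2n+1}$ of $\mathbb C^{2n+1}$ with $e_{n+i}=\overline{e_i}$, $e_{2n+1}$ real, $Q(e_i,e_{n+i})=1$ $(1\le i\le n)$, $Q(e_{2n+1},e_{2n+1})=1$ and all other pairings zero, where $Q$ is the complex-bilinear extension of the standard inner product of $\mathbb R^{2n+1}$. $E_i$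 is the diagonal matrix with $E_ie_i=\sqrt{-1}e_i$, $E_ie_{n+i}=-\sqrt{-1}e_{n+i}$, and zero on the other basis vectors; $\mathfrak t=\{\sum a_iE_i\}$; $L_i(E_j)=\sqrt{-1}\,\delta_{ij}$. $\Delta^+=\{L_i\pm L_j\}_{i<j}\cup\{L_i\}_i$, with simple roots $\alpha_i=L_i-L_{i+1}$ ($1\le i\le n-1$), $\alpha_n=L_n$, so $H_i=E_1+\ldots+E_i$. The fundamental weights are $\omega_i=L_1+\ldots+L_i$ for $i\le n-1$ and $\omega_n=\frac12(L_1+\ldots+L_n)$; $\rho_k$ is the irreducible representation with highest weight $\omega_k$ ($1\le k\le n$). The adjoint representation has highest weight $L_1+L_2$ (which is $\omega_2$ for $n\ge3$), and its uniton number is denoted $r_{\rho_2}(\xi)$; the standard representation has highest weight $L_1$, and its uniton number is denoted $r_{\rho_1}(\xi)$. Real Grassmannian. $G^{\mathbb R}_m(2n+1)$ is the set of complex $m$-dimensional subspaces $V\subset\mathbb C^{2n+1}$ with $V=\overline V$, and $\iota:G^{\mathbb R}_m(2n+1)\to SO(2n+1)$ is the map $\iota(V)=\pi_V^\perp-\pi_V$ if $m$ is even and $\iota(V)=\pi_V-\pi_V^\perp$ if $m$ is odd, where $\pi_V$ is the orthogonal projection onto $V$ and $\pi_V^\perp=\mathrm{Id}-\pi_V$. *)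

theory Defs
  imports "HOL-Analysis.Analysis"
begin

text \<open>
  The dimension \<open>2 * n + 1\<close> is the cardinality of the index type \<open>'d\<close>; the vectors
  \<open>e 1, \<dots>, e (2 * n + 1)\<close> are numbered from \<open>1\<close>. Real matrices (in particular
  \<open>SO(2n+1)\<close>, its Lie algebra and its maximal torus) are regarded as complex matrices.
\<close>

section \<open>Matrices and the orthogonal group\<close>

definition mscale :: "complex \<Rightarrow> complex^'d^'d \<Rightarrow> complex^'d^'d" where
  "mscale c A = map_matrix (\<lambda>x. c * x) A"

global_interpretation cmat: vector_space "mscale :: complex \<Rightarrow> complex^'d^'d \<Rightarrow> complex^'d^'d"
  by unfold_locales (simp_all add: mscale_def vec_eq_iff algebra_simps)

definition mexp :: "complex^'d^'d \<Rightarrow> complex^'d^'d" where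
  "mexp A = (\<Sum>k. (1 / fact k) *\<^sub>R (((**) A) ^^ k) (mat 1))"

definition SO :: "(complex^'d^'d) set" where
  "SO = map_matrix complex_of_real ` {g. rotation_matrix g}"

text \<open>The complexified Lie algebra of \<open>SO\<close>.\<close>

definition soC :: "(complex^'d^'d) set" where
  "soC = {X. transpose X = - X}"

definition bracket :: "complex^'d^'d \<Rightarrow> complex^'d^'d \<Rightarrow> complex^'d^'d" where
  "bracket X Y = X ** Y - Y ** X"

definition vconj :: "complex^'d \<Rightarrow> complex^'d" where
  "vconj v = (\<chi> i. cnj (v $ i))"

definition Qform :: "complex^'d \<Rightarrow> complex^'d \<Rightarrow> complex" where
  "Qform u v = (\<Sum>i\<in>UNIV. u $ i * v $ i)"

definition herm :: "complex^'d \<Rightarrow> complex^'d \<Rightarrow> complex" where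
  "herm u v = (\<Sum>i\<in>UNIV. u $ i * cnj (v $ i))"

section \<open>The maximal torus, roots and fundamental weights\<close>

definition adapted_basis :: "nat \<Rightarrow> (nat \<Rightarrow> complex^'d) \<Rightarrow> bool" where
  "adapted_basis n e \<longleftrightarrow>
     inj_on e {1..2*n+1} \<and> vec.independent (e ` {1..2*n+1}) \<and>
     vec.span (e ` {1..2*n+1}) = UNIV \<and>
     (\<forall>i\<in>{1..n}. e (n+i) = vconj (e i)) \<and> vconj (e (2*n+1)) = e (2*n+1) \<and>
     (\<forall>i\<in>{1..2*n+1}. \<forall>j\<in>{1..2*n+1}. Qform (e i) (e j) =
        (if (i \<le> n \<and> j = n + i) \<or> (j \<le> n \<and> i = n + j) \<or> (i = 2*n+1 \<and> j = 2*n+1)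
         then 1 else 0))"

definition E :: "nat \<Rightarrow> (nat \<Rightarrow> complex^'d) \<Rightarrow> nat \<Rightarrow> complex^'d^'d" where
  "E n e i = (THE A. A *v e i = \<i> *s e i \<and> A *v e (n+i) = (-\<i>) *s e (n+i) \<and>
                (\<forall>j\<in>{1..2*n+1} - {i, n+i}. A *v e j = 0))"

definition torus :: "nat \<Rightarrow> (nat \<Rightarrow> complex^'d) \<Rightarrow> (complex^'d^'d) set" where
  "torus n e = {\<Sum>i=1..n. a i *\<^sub>R E n e i | a :: nat \<Rightarrow> real. True}"

text \<open>
  Linear functionals on the torus are functions on all matrices whose values matter only on
  \<^term>\<open>torus n e\<close>. The functional \<open>L n e i\<close> is the real-linear one with
  \<open>L n e i (E n e j) = \<i> * \<delta>\<close>, where \<open>\<delta>\<close> is \<open>1\<close> if \<open>i = j\<close> and \<open>0\<close> otherwise.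
\<close>

definition L :: "nat \<Rightarrow> (nat \<Rightarrow> complex^'d) \<Rightarrow> nat \<Rightarrow> complex^'d^'d \<Rightarrow> complex" where
  "L n e i \<eta> = (THE c. \<exists>a :: nat \<Rightarrow> real. \<eta> = (\<Sum>j=1..n. a j *\<^sub>R E n e j) \<and> c = \<i> * of_real (a i))"

definition positive_roots :: "nat \<Rightarrow> (nat \<Rightarrow> complex^'d) \<Rightarrow> (complex^'d^'d \<Rightarrow> complex) set" where
  "positive_roots n e =
     {\<lambda>\<eta>. L n e i \<eta> + L n e j \<eta> | i j. 1 \<le> i \<and> i < j \<and> j \<le> n} \<union>
     {\<lambda>\<eta>. L n e i \<eta> - L n e j \<eta> | i j. 1 \<le> i \<and> i < j \<and> j \<le> n} \<union>
     {L n e i | i. 1 \<le> i \<and> i \<le> n}"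

definition simple_root :: "nat \<Rightarrow> (nat \<Rightarrow> complex^'d) \<Rightarrow> nat \<Rightarrow> complex^'d^'d \<Rightarrow> complex" where
  "simple_root n e i \<eta> = (if i < n then L n e i \<eta> - L n e (i+1) \<eta> else L n e n \<eta>)"

definition fundamental_weight :: "nat \<Rightarrow> (nat \<Rightarrow> complex^'d) \<Rightarrow> nat \<Rightarrow> complex^'d^'d \<Rightarrow> complex" where
  "fundamental_weight n e k \<eta> =
     (if k < n then (\<Sum>i=1..k. L n e i \<eta>) else (1/2) * (\<Sum>i=1..n. L n e i \<eta>))"

section \<open>Symmetric canonical elements\<close>

definition integer_lattice :: "nat \<Rightarrow> (nat \<Rightarrow> complex^'d) \<Rightarrow> (complex^'d^'d) set" where
  "integer_lattice n e = {\<xi> \<in> torus n e. mexp ((2 * pi) *\<^sub>R \<xi>) = mat 1}"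

definition dominant_lattice :: "nat \<Rightarrow> (nat \<Rightarrow> complex^'d) \<Rightarrow> (complex^'d^'d) set" where
  "dominant_lattice n e =
     {\<xi> \<in> integer_lattice n e. \<forall>\<alpha>\<in>positive_roots n e. \<alpha> \<xi> / \<i> \<in> \<real>\<^sub>\<ge>\<^sub>0}"

definition half_lattice :: "nat \<Rightarrow> (nat \<Rightarrow> complex^'d) \<Rightarrow> (complex^'d^'d) set" where
  "half_lattice n e = {\<xi> \<in> torus n e. mexp (pi *\<^sub>R \<xi>) = mat 1}"

definition ad_eigenspace :: "complex^'d^'d \<Rightarrow> int \<Rightarrow> (complex^'d^'d) set" where
  "ad_eigenspace \<xi> j = {X \<in> soC. bracket \<xi> X = mscale (\<i> * of_int j) X}"

definition parabolic :: "complex^'d^'d \<Rightarrow> int \<Rightarrow> (complex^'d^'d) set" where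
  "parabolic \<xi> i = cmat.span (\<Union>j\<in>{..i}. ad_eigenspace \<xi> j)"

definition prec :: "complex^'d^'d \<Rightarrow> complex^'d^'d \<Rightarrow> bool" where
  "prec \<xi> \<xi>' \<longleftrightarrow> (\<forall>i\<ge>0. parabolic \<xi> i \<subseteq> parabolic \<xi>' i)"

definition prec_I :: "nat \<Rightarrow> (nat \<Rightarrow> complex^'d) \<Rightarrow> complex^'d^'d \<Rightarrow> complex^'d^'d \<Rightarrow> bool" where
  "prec_I n e \<xi> \<xi>' \<longleftrightarrow> prec \<xi> \<xi>' \<and> \<xi> - \<xi>' \<in> half_lattice n e"

definition symmetric_canonical :: "nat \<Rightarrow> (nat \<Rightarrow> complex^'d) \<Rightarrow> complex^'d^'d \<Rightarrow> bool" where
  "symmetric_canonical n e \<xi> \<longleftrightarrow>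
     \<xi> \<in> dominant_lattice n e \<and>
     (\<forall>\<xi>'\<in>dominant_lattice n e. prec_I n e \<xi> \<xi>' \<longrightarrow> \<xi>' = \<xi>)"

text \<open>
  With the principal logarithm, \<open>gamma \<xi>\<close> is the homomorphism of the unit circle generated
  by \<open>\<xi>\<close>; for \<open>\<xi>\<close> in the integer lattice the choice of branch is irrelevant.
\<close>

definition gamma :: "complex^'d^'d \<Rightarrow> complex \<Rightarrow> complex^'d^'d" where
  "gamma \<xi> z = mexp (mscale (- \<i> * Ln z) \<xi>)"

definition N_class :: "complex^'d^'d \<Rightarrow> (complex^'d^'d) set" where
  "N_class \<xi> = {g ** gamma \<xi> (-1) ** matrix_inv g | g. g \<in> SO}"

section \<open>Real Grassmannians\<close>

definition real_grassmannian :: "nat \<Rightarrow> (complex^'d) set set" where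
  "real_grassmannian m = {V. vec.subspace V \<and> vec.dim V = m \<and> vconj ` V = V}"

definition orth_proj :: "(complex^'d) set \<Rightarrow> complex^'d^'d" where
  "orth_proj V = (THE P. \<forall>v. P *v v \<in> V \<and> (\<forall>w\<in>V. herm (v - P *v v) w = 0))"

definition iota :: "nat \<Rightarrow> (complex^'d) set \<Rightarrow> complex^'d^'d" where
  "iota m V = (if even m then (mat 1 - orth_proj V) - orth_proj V
               else orth_proj V - (mat 1 - orth_proj V))"

section \<open>Representations and the uniton number\<close>

text \<open>
  A representation of \<^const>\<open>soC\<close> acts on a subspace \<open>V\<close> of an arbitrary complex vector space
  with scalar multiplication \<open>smul\<close>; only the values \<open>\<rho> X v\<close> with \<open>X \<in> soC\<close> and \<open>v \<in> V\<close> matter.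
\<close>

definition representation ::
  "(complex \<Rightarrow> 'v::ab_group_add \<Rightarrow> 'v) \<Rightarrow> 'v set \<Rightarrow> (complex^'d^'d \<Rightarrow> 'v \<Rightarrow> 'v) \<Rightarrow> bool" where
  "representation smul V \<rho> \<longleftrightarrow>
     vector_space smul \<and> module.subspace smul V \<and> (\<exists>B. finite B \<and> module.span smul B = V) \<and>
     (\<forall>X\<in>soC. \<forall>v\<in>V. \<rho> X v \<in> V) \<and>
     (\<forall>X\<in>soC. \<forall>v\<in>V. \<forall>w\<in>V. \<rho> X (v + w) = \<rho> X v + \<rho> X w) \<and>
     (\<forall>X\<in>soC. \<forall>c. \<forall>v\<in>V. \<rho> X (smul c v) = smul c (\<rho> X v)) \<and>
     (\<forall>X\<in>soC. \<forall>Y\<in>soC. \<forall>v\<in>V. \<rho> (X + Y) v = \<rho> X v + \<rho> Y v) \<and>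
     (\<forall>X\<in>soC. \<forall>c. \<forall>v\<in>V. \<rho> (mscale c X) v = smul c (\<rho> X v)) \<and>
     (\<forall>X\<in>soC. \<forall>Y\<in>soC. \<forall>v\<in>V. \<rho> (bracket X Y) v = \<rho> X (\<rho> Y v) - \<rho> Y (\<rho> X v))"

definition irreducible_representation ::
  "(complex \<Rightarrow> 'v::ab_group_add \<Rightarrow> 'v) \<Rightarrow> 'v set \<Rightarrow> (complex^'d^'d \<Rightarrow> 'v \<Rightarrow> 'v) \<Rightarrow> bool" where
  "irreducible_representation smul V \<rho> \<longleftrightarrow>
     representation smul V \<rho> \<and> V \<noteq> {0} \<and>
     (\<forall>W. module.subspace smul W \<and> W \<subseteq> V \<and> (\<forall>X\<in>soC. \<forall>w\<in>W. \<rho> X w \<in> W) \<longrightarrow> W = {0} \<or> W = V)"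

definition weight ::
  "nat \<Rightarrow> (nat \<Rightarrow> complex^'d) \<Rightarrow> (complex \<Rightarrow> 'v::ab_group_add \<Rightarrow> 'v) \<Rightarrow> 'v set \<Rightarrow>
   (complex^'d^'d \<Rightarrow> 'v \<Rightarrow> 'v) \<Rightarrow> (complex^'d^'d \<Rightarrow> complex) \<Rightarrow> bool" where
  "weight n e smul V \<rho> \<mu> \<longleftrightarrow>
     (\<exists>v\<in>V. v \<noteq> 0 \<and> (\<forall>\<eta>\<in>torus n e. \<rho> \<eta> v = smul (\<mu> \<eta>) v))"

text \<open>
  The order on weights: \<open>\<mu> - \<nu>\<close> is a sum of simple roots with nonnegative integer coefficients.
  The highest (lowest) weight is the greatest (least) weight for this order.
\<close>

definition weight_le ::
  "nat \<Rightarrow> (nat \<Rightarrow> complex^'d) \<Rightarrow> (complex^'d^'d \<Rightarrow> complex) \<Rightarrow> (complex^'d^'d \<Rightarrow> complex) \<Rightarrow> bool" where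
  "weight_le n e \<nu> \<mu> \<longleftrightarrow>
     (\<exists>c :: nat \<Rightarrow> nat. \<forall>\<eta>\<in>torus n e. \<mu> \<eta> - \<nu> \<eta> = (\<Sum>i=1..n. of_nat (c i) * simple_root n e i \<eta>))"

definition highest_weight ::
  "nat \<Rightarrow> (nat \<Rightarrow> complex^'d) \<Rightarrow> (complex \<Rightarrow> 'v::ab_group_add \<Rightarrow> 'v) \<Rightarrow> 'v set \<Rightarrow>
   (complex^'d^'d \<Rightarrow> 'v \<Rightarrow> 'v) \<Rightarrow> (complex^'d^'d \<Rightarrow> complex) \<Rightarrow> bool" where
  "highest_weight n e smul V \<rho> \<omega> \<longleftrightarrow>
     weight n e smul V \<rho> \<omega> \<and> (\<forall>\<nu>. weight n e smul V \<rho> \<nu> \<longrightarrow> weight_le n e \<nu> \<omega>)"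

definition lowest_weight ::
  "nat \<Rightarrow> (nat \<Rightarrow> complex^'d) \<Rightarrow> (complex \<Rightarrow> 'v::ab_group_add \<Rightarrow> 'v) \<Rightarrow> 'v set \<Rightarrow>
   (complex^'d^'d \<Rightarrow> 'v \<Rightarrow> 'v) \<Rightarrow> (complex^'d^'d \<Rightarrow> complex) \<Rightarrow> bool" where
  "lowest_weight n e smul V \<rho> \<omega> \<longleftrightarrow>
     weight n e smul V \<rho> \<omega> \<and> (\<forall>\<nu>. weight n e smul V \<rho> \<nu> \<longrightarrow> weight_le n e \<omega> \<nu>)"

definition uniton_number ::
  "nat \<Rightarrow> (nat \<Rightarrow> complex^'d) \<Rightarrow> (complex \<Rightarrow> 'v::ab_group_add \<Rightarrow> 'v) \<Rightarrow> 'v set \<Rightarrow>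
   (complex^'d^'d \<Rightarrow> 'v \<Rightarrow> 'v) \<Rightarrow> complex^'d^'d \<Rightarrow> real" where
  "uniton_number n e smul V \<rho> \<xi> =
     (THE r. \<exists>\<omega> \<phi>. highest_weight n e smul V \<rho> \<omega> \<and> lowest_weight n e smul V \<rho> \<phi> \<and>
        complex_of_real r = (1 / \<i>) * (\<omega> \<xi> - \<phi> \<xi>))"

definition uniton_number_standard :: "nat \<Rightarrow> (nat \<Rightarrow> complex^'d) \<Rightarrow> complex^'d^'d \<Rightarrow> real" where
  "uniton_number_standard n e \<xi> = uniton_number n e (*s) (UNIV :: (complex^'d) set) (*v) \<xi>"

definition uniton_number_adjoint :: "nat \<Rightarrow> (nat \<Rightarrow> complex^'d) \<Rightarrow> complex^'d^'d \<Rightarrow> real" where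
  "uniton_number_adjoint n e \<xi> = uniton_number n e mscale (soC :: (complex^'d^'d) set) bracket \<xi>"

end

theory Submission
  imports Defs
begin

text \<open>
  Write \<open>\<xi> = a\<^sub>1 E\<^sub>1 + \<dots> + a\<^sub>n E\<^sub>n\<close>. The argument bounds the coordinates \<open>a\<^sub>j\<close> and expresses every uniton
  number through them.

  \<^bold>\<open>Coordinates.\<close> Membership in the dominant lattice says that the \<open>a\<^sub>j\<close> are integers with
  \<open>a\<^sub>1 \<ge> \<dots> \<ge> a\<^sub>n \<ge> 0\<close>. Put \<open>a\<^bsub>n+1\<^esub> = 0\<close>. If some jump \<open>a\<^sub>k - a\<^bsub>k+1\<^esub>\<close> were at least \<open>2\<close>, then
  \<open>\<xi> - 2 H\<^sub>k\<close> would still be dominant, would differ from \<open>\<xi>\<close> by an element of the half lattice, and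
  would lie above \<open>\<xi>\<close>; so maximality makes all jumps at most \<open>1\<close> (\<open>canonical_jump\<close>). Therefore
  \<open>a\<^sub>j \<le> n - j + 1\<close>, and each of \<open>1, \<dots>, a\<^sub>1\<close> occurs among the \<open>a\<^sub>j\<close> (\<open>descending_values\<close>).

  The hypothesis on \<open>N_class \<xi>\<close> gives \<open>exp (\<pi> \<xi>) = iota m W\<close> for some \<open>W\<close> of dimension \<open>m\<close>, and \<open>W\<close> is an
  eigenspace of this involution: for \<open>-1\<close> if \<open>m\<close> is even, for \<open>1\<close> if \<open>m\<close> is odd. On the other hand
  \<open>exp (\<pi> \<xi>)\<close> acts by \<open>(-1)\<close> to the power \<open>a\<^sub>j\<close> on both \<open>e\<^sub>j\<close> and \<open>e\<^bsub>n+j\<^esub>\<close> and trivially on the last basis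
  vector. So \<open>m\<close> is twice the number of odd \<open>a\<^sub>j\<close>, respectively one more than twice the number of
  even \<open>a\<^sub>j\<close>. Since all of \<open>1, \<dots>, a\<^sub>1\<close> occur and alternate in parity, \<open>a\<^sub>1 \<le> m\<close>
  (\<open>largest_le_parity_count\<close>).

  \<^bold>\<open>Uniton numbers.\<close> In type \<open>B\<^sub>n\<close> the map \<open>-1\<close> on the torus is the product of the reflections in the
  short roots \<open>L\<^sub>1, \<dots>, L\<^sub>n\<close>. Each of these belongs to a copy of \<open>sl(2)\<close> in the Lie algebra, and elementary
  \<open>sl(2)\<close> theory moves a weight vector to one of the reflected weight (\<open>weight_vector_reflect\<close>). So the
  weights of a finite-dimensional representation are symmetric, the lowest weight is the negative of
  the highest weight \<open>\<omega>\<close>, and the uniton number is \<open>2 \<omega>(\<xi>) / \<i>\<close> (\<open>uniton_number_eq\<close>). It equals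
  \<open>2 (a\<^sub>1 + \<dots> + a\<^sub>k)\<close> for \<open>\<omega>\<^sub>k\<close> with \<open>k < n\<close>, half of this expression for the spin weight \<open>\<omega>\<^sub>n\<close>, \<open>2 a\<^sub>1\<close> for the
  standard and \<open>2 (a\<^sub>1 + a\<^sub>2)\<close> for the adjoint representation (\<open>2 a\<^sub>1\<close> if \<open>n = 1\<close>). The bounds
  \<open>a\<^sub>j \<le> min m (n - j + 1)\<close> finish the proof: the minimum is \<open>m\<close> exactly for \<open>j \<le> n - m + 1\<close>, which is why
  the estimate changes its form there.
\<close>

section \<open>Bivectors and the orthogonal Lie algebra\<close>

text \<open>
  The matrix \<open>u v\<^sup>T - v u\<^sup>T\<close>. Under this identification of bivectors with skew matrices the bracket is the
  natural action on bivectors (\<open>bracket_wedge\<close> below), so that bivectors of eigenvectors of the torus are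
  eigenvectors of its adjoint action.
\<close>

definition wedge :: "complex^'d \<Rightarrow> complex^'d \<Rightarrow> complex^'d^'d" where
  "wedge u v = (\<chi> i j. u $ i * v $ j - v $ i * u $ j)"

lemma Qform_add_right: "Qform u (v + v') = Qform u v + Qform u v'"
  and Qform_scale_left: "Qform (c *s u) v = c * Qform u v"
  and Qform_scale_right: "Qform u (c *s v) = c * Qform u v"
  and Qform_zero_right: "Qform u 0 = 0"
  by (simp_all add: Qform_def sum.distrib sum_distrib_left algebra_simps)

lemma Qform_commute: "Qform u v = Qform v u"
  by (simp add: Qform_def mult.commute)

lemma Qform_sum_right: "Qform u (\<Sum>p\<in>A. f p) = (\<Sum>p\<in>A. Qform u (f p))"
  by (induction A rule: infinite_finite_induct) (simp_all add: Qform_zero_right Qform_add_right)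

lemma soC_iff: "X \<in> soC \<longleftrightarrow> (\<forall>i j. X $ i $ j = - X $ j $ i)"
proof -
  have "X \<in> soC \<longleftrightarrow> (\<forall>i j. X $ j $ i = - X $ i $ j)"
    by (simp only: soC_def transpose_def vec_eq_iff mem_Collect_eq vec_lambda_beta uminus_vec_def)
  then show ?thesis by blast
qed

lemma soC_entry: "X \<in> soC \<Longrightarrow> X $ i $ j = - X $ j $ i"
  using soC_iff by blast

lemma soC_skew:
  assumes "X \<in> soC"
  shows "Qform (X *v u) v = - Qform u (X *v v)"
proof -
  have "Qform (X *v u) v = (\<Sum>i\<in>UNIV. \<Sum>j\<in>UNIV. X $ i $ j * u $ j * v $ i)"
    by (simp add: Qform_def matrix_vector_mult_def sum_distrib_right)
  also have "\<dots> = (\<Sum>j\<in>UNIV. \<Sum>i\<in>UNIV. X $ i $ j * u $ j * v $ i)"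
    by (rule sum.swap)
  also have "\<dots> = (\<Sum>j\<in>UNIV. \<Sum>i\<in>UNIV. - (u $ j * (X $ j $ i * v $ i)))"
    by (intro sum.cong refl) (subst soC_entry[OF assms], simp)
  also have "\<dots> = - Qform u (X *v v)"
    by (simp add: Qform_def matrix_vector_mult_def sum_distrib_left sum_negf)
  finally show ?thesis .
qed

lemma soC_alternating: "X \<in> soC \<Longrightarrow> Qform u (X *v u) = 0"
  using soC_skew[of X u u] by (simp add: Qform_commute)

lemma wedge_in_soC [simp]: "wedge u v \<in> soC"
  by (simp add: wedge_def soC_def transpose_def vec_eq_iff)

lemma wedge_self [simp]: "wedge u u = 0"
  by (simp add: wedge_def vec_eq_iff)

lemma wedge_mult_vector: "wedge u v *v x = Qform v x *s u - Qform u x *s v"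
  by (simp add: wedge_def Qform_def matrix_vector_mult_def vec_eq_iff sum_distrib_left
      sum_distrib_right algebra_simps sum_subtractf)

lemma bracket_wedge:
  assumes "A \<in> soC"
  shows "bracket A (wedge u v) = wedge (A *v u) v + wedge u (A *v v)"
proof -
  have "(wedge u v ** A) $ i $ j = - (u $ i * (A *v v) $ j) + v $ i * (A *v u) $ j" for i j
  proof -
    have "(wedge u v ** A) $ i $ j = (\<Sum>k\<in>UNIV. (u $ i * v $ k - v $ i * u $ k) * A $ k $ j)"
      by (simp add: wedge_def matrix_matrix_mult_def)
    also have "\<dots> = (\<Sum>k\<in>UNIV. - ((u $ i * v $ k - v $ i * u $ k) * A $ j $ k))"
      by (intro sum.cong refl) (subst soC_entry[OF assms], simp)
    also have "\<dots> = - (u $ i * (A *v v) $ j) + v $ i * (A *v u) $ j"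
      by (simp add: matrix_vector_mult_def sum_distrib_left algebra_simps sum_subtractf sum_negf)
    finally show ?thesis .
  qed
  moreover have "(A ** wedge u v) $ i $ j = (A *v u) $ i * v $ j - (A *v v) $ i * u $ j" for i j
    by (simp add: wedge_def matrix_matrix_mult_def matrix_vector_mult_def sum_distrib_left
      sum_distrib_right algebra_simps sum_subtractf)
  ultimately show ?thesis
    by (simp add: bracket_def vec_eq_iff) (simp add: wedge_def algebra_simps)
qed

lemma wedge_scale_left: "wedge (c *s u) v = mscale c (wedge u v)"
  and wedge_scale_right: "wedge u (c *s v) = mscale c (wedge u v)"
  by (simp_all add: wedge_def mscale_def vec_eq_iff algebra_simps)

lemma wedge_zero [simp]: "wedge u 0 = 0" "wedge 0 u = 0"
  by (simp_all add: wedge_def vec_eq_iff)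

lemma mscale_mscale: "mscale a (mscale b A) = mscale (a * b) A"
  by (simp add: mscale_def vec_eq_iff)

lemma mscale_nth: "mscale c A $ i $ j = c * A $ i $ j"
  by (simp add: mscale_def)

lemma mscale_mult_vector: "mscale c A *v v = c *s (A *v v)"
  by (simp add: mscale_def matrix_vector_mult_def vec_eq_iff sum_distrib_left algebra_simps)

lemma mult_vector_sum: "A *v (\<Sum>p\<in>S. f p) = (\<Sum>p\<in>S. A *v f p)"
  for A :: "complex^'d^'m"
  by (induction S rule: infinite_finite_induct) (simp_all add: matrix_vector_right_distrib)

lemma sum_mult_vector: "(\<Sum>p\<in>S. F p) *v v = (\<Sum>p\<in>S. F p *v v)"
  for v :: "complex^'d"
  by (induction S rule: infinite_finite_induct) (simp_all add: matrix_vector_mult_add_rdistrib)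

lemma mscale_matrix_mult: "mscale c A ** B = mscale c (A ** B)"
  and matrix_mult_mscale: "A ** mscale c B = mscale c (A ** B)"
  by (simp_all add: mscale_def matrix_matrix_mult_def vec_eq_iff sum_distrib_left algebra_simps)

lemma scaleR_eq_mscale: "r *\<^sub>R A = mscale (of_real r) A"
proof -
  have "(r *\<^sub>R A) $ i $ j = mscale (of_real r) A $ i $ j" for i j
    by (simp add: mscale_nth) (simp add: scaleR_conv_of_real)
  then show ?thesis by (simp add: vec_eq_iff)
qed

lemma mscale_diff: "mscale c (A - B) = mscale c A - mscale c B"
  by (simp add: mscale_def vec_eq_iff algebra_simps)

lemma bracket_mscale_left: "bracket (mscale c X) Y = mscale c (bracket X Y)"
  and bracket_mscale_right: "bracket X (mscale c Y) = mscale c (bracket X Y)"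
  by (simp_all add: bracket_def mscale_matrix_mult matrix_mult_mscale mscale_diff)

lemma bracket_mult_vector: "bracket X Y *v v = X *v (Y *v v) - Y *v (X *v v)"
  by (simp add: bracket_def matrix_vector_mul_assoc matrix_vector_mult_diff_rdistrib)

lemma transpose_bracket:
  fixes X Y :: "complex^'d^'d"
  shows "transpose (bracket X Y) = bracket (transpose Y) (transpose X)"
proof -
  have "transpose (A - B) = transpose A - transpose B" for A B :: "complex^'d^'d"
    by (simp add: transpose_def vec_eq_iff)
  then show ?thesis by (simp add: bracket_def matrix_transpose_mul)
qed

lemma bracket_uminus: "bracket (- X) (- Y) = bracket X Y"
  by (simp add: bracket_def matrix_matrix_mult_def vec_eq_iff)

lemma bracket_skew: "bracket X Y = - bracket Y X"
  by (simp add: bracket_def)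

lemma bracket_in_soC: "X \<in> soC \<Longrightarrow> Y \<in> soC \<Longrightarrow> bracket X Y \<in> soC"
  unfolding soC_def mem_Collect_eq transpose_bracket by (metis bracket_uminus bracket_skew)

lemma mscale_in_soC: "X \<in> soC \<Longrightarrow> mscale c X \<in> soC"
  unfolding soC_iff mscale_nth by (metis mult_minus_right)

lemma add_in_soC: "X \<in> soC \<Longrightarrow> Y \<in> soC \<Longrightarrow> X + Y \<in> soC"
  unfolding soC_iff vector_add_component by (metis minus_add_distrib)

lemma zero_in_soC: "0 \<in> soC"
  by (simp add: soC_iff)

text \<open>
  The right-hand side exhibits a finite spanning set; the adjoint representation needs one.
\<close>

lemma soC_span_wedges:
  "(soC :: (complex^'d^'d) set) = cmat.span (range (\<lambda>(i, j). wedge (axis i 1) (axis j 1)))"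
    (is "_ = cmat.span ?B")
proof
  have "X \<in> cmat.span ?B" if X: "X \<in> soC" for X :: "complex^'d^'d"
  proof -
    have "X = (\<Sum>i\<in>UNIV. \<Sum>j\<in>UNIV. mscale (X $ i $ j / 2) (wedge (axis i 1) (axis j 1)))"
      (is "_ = ?S")
    proof -
      have "?S $ a $ b = X $ a $ b" for a b
      proof -
        have "?S $ a $ b = (\<Sum>i\<in>UNIV. \<Sum>j\<in>UNIV. (if a = i then (if b = j then X $ i $ j / 2 else 0) else 0)
             - (if b = i then (if a = j then X $ i $ j / 2 else 0) else 0))"
          by (simp add: mscale_nth wedge_def axis_def) (intro sum.cong refl, auto)
        also have "\<dots> = X $ a $ b / 2 - X $ b $ a / 2"
        proof -
          have "(\<Sum>j\<in>UNIV. if c = i then if d = j then X $ i $ j / 2 else 0 else 0)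
              = (if c = i then X $ i $ d / 2 else 0)" for c d i
            by (cases "c = i") simp_all
          then show ?thesis by (simp add: sum_subtractf)
        qed
        also have "\<dots> = X $ a $ b"
          using soC_entry[OF X, of b a] by simp
        finally show ?thesis .
      qed
      then show ?thesis by (simp add: vec_eq_iff)
    qed
    moreover have "?S \<in> cmat.span ?B"
      by (intro cmat.span_sum cmat.span_scale cmat.span_base) auto
    ultimately show ?thesis by simp
  qed
  then show "soC \<subseteq> cmat.span ?B" by blast
  show "cmat.span ?B \<subseteq> soC"
    by (rule cmat.span_minimal)
       (auto simp: cmat.subspace_def zero_in_soC add_in_soC mscale_in_soC)
qed

section \<open>Adapted bases and the maximal torus\<close>

locale adapted =
  fixes n :: nat and e :: "nat \<Rightarrow> complex^'d"
  assumes n_pos: "1 \<le> n" and adapted_basis: "adapted_basis n e"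
begin

definition idx :: "nat set" where
  "idx = {1..2 * n + 1}"

lemma finite_idx [simp]: "finite idx"
  by (simp add: idx_def)

text \<open>
  \<open>e (opp p)\<close> is the basis vector dual to \<open>e p\<close> under \<open>Qform\<close>, so coordinates are
  read off by pairing with it. On \<open>e p\<close> the torus element \<open>tor a\<close> has the eigenvalue \<open>\<i> * lam a p\<close>, and
  \<open>lam\<close> changes sign under \<open>opp\<close>.
\<close>

definition opp :: "nat \<Rightarrow> nat" where
  "opp p = (if p \<le> n then n + p else if p \<le> 2 * n then p - n else p)"

definition tor :: "(nat \<Rightarrow> real) \<Rightarrow> complex^'d^'d" where
  "tor a = (\<Sum>j=1..n. a j *\<^sub>R E n e j)"

definition lam :: "(nat \<Rightarrow> real) \<Rightarrow> nat \<Rightarrow> real" where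
  "lam a p = (if p \<le> n then a p else if p \<le> 2 * n then - a (p - n) else 0)"

lemma opp_in: "p \<in> idx \<Longrightarrow> opp p \<in> idx"
  by (auto simp: opp_def idx_def)

lemma opp_opp: "p \<in> idx \<Longrightarrow> opp (opp p) = p"
  by (auto simp: opp_def idx_def)

lemma lam_opp: "p \<in> idx \<Longrightarrow> lam a (opp p) = - lam a p"
  by (auto simp: opp_def lam_def idx_def)

lemma Qform_basis:
  assumes "p \<in> idx" "q \<in> idx"
  shows "Qform (e p) (e q) = (if q = opp p then 1 else 0)"
proof -
  have "Qform (e p) (e q) = (if (p \<le> n \<and> q = n + p) \<or> (q \<le> n \<and> p = n + q) \<or> (p = 2*n+1 \<and> q = 2*n+1)
         then 1 else 0)"
    using adapted_basis assms unfolding adapted_basis_def idx_def by blast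
  also have "\<dots> = (if q = opp p then 1 else 0)"
    using assms by (auto simp: opp_def idx_def)
  finally show ?thesis .
qed

lemma Qform_opp:
  assumes "p \<in> idx" "q \<in> idx"
  shows "Qform (e (opp p)) (e q) = (if q = p then 1 else 0)"
  using Qform_basis[OF opp_in[OF assms(1)] assms(2)] opp_opp[OF assms(1)] by simp

lemma basis_nonzero: "p \<in> idx \<Longrightarrow> e p \<noteq> 0"
  using Qform_opp[of p p] by (auto simp: Qform_zero_right)

lemma expansion: "v = (\<Sum>p\<in>idx. Qform (e (opp p)) v *s e p)"
proof -
  have inj: "inj_on e idx" and sp: "vec.span (e ` idx) = UNIV"
    using adapted_basis by (auto simp: adapted_basis_def idx_def)
  obtain u where u: "v = (\<Sum>w\<in>e ` idx. u w *s w)"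
  proof -
    have "v \<in> range (\<lambda>u. \<Sum>w\<in>e ` idx. u w *s w)"
      using sp vec.span_finite[of "e ` idx"] by simp
    then show ?thesis using that by blast
  qed
  then have v: "v = (\<Sum>p\<in>idx. u (e p) *s e p)"
    using sum.reindex[OF inj, of "\<lambda>w. u w *s w"] by (simp only: o_def)
  have "Qform (e (opp p)) v = u (e p)" if "p \<in> idx" for p
  proof -
    have "Qform (e (opp p)) v = (\<Sum>q\<in>idx. u (e q) * (if q = p then 1 else 0))"
      by (subst v) (simp add: Qform_sum_right Qform_scale_right Qform_opp[OF that])
    also have "\<dots> = (\<Sum>q\<in>idx. if q = p then u (e q) else 0)"
      by (intro sum.cong refl) simp
    also have "\<dots> = u (e p)" using that by simp
    finally show ?thesis .
  qed
  then show ?thesis using v by simp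
qed

lemma matrix_eq_on_basis:
  assumes "\<And>p. p \<in> idx \<Longrightarrow> A *v e p = B *v e p"
  shows "A = B"
proof -
  have "A *v v = B *v v" for v
    by (subst (1 2) expansion[of v]) (simp add: mult_vector_sum vector_scalar_commute assms)
  then show ?thesis by (simp add: matrix_eq)
qed

text \<open>
  Expanding the columns of \<open>X\<close> in the basis \<open>e\<close> writes \<open>X\<close> as a sum of \<open>e\<^sub>p e\<^sub>q\<^sup>T\<close> with skew coefficients;
  symmetrising doubles each term, whence the factor \<open>1/2\<close>. Since bivectors of basis vectors are
  eigenvectors of the torus, this decomposes \<open>X\<close> into weight vectors of the adjoint action.
\<close>

lemma soC_expansion:
  assumes "X \<in> soC"
  shows "X = (\<Sum>p\<in>idx. \<Sum>q\<in>idx.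
               mscale (Qform (e (opp p)) (X *v e (opp q)) / 2) (wedge (e p) (e q)))" (is "_ = ?S")
proof -
  let ?c = "\<lambda>p q. Qform (e (opp p)) (X *v e (opp q))"
  have "?S *v v = X *v v" for v
  proof -
    have skew: "?c q p = - ?c p q" for p q
      using soC_skew[OF assms] Qform_commute by (metis minus_minus)
    have mv: "(\<Sum>p\<in>idx. \<Sum>q\<in>idx. F p q) *v v = (\<Sum>p\<in>idx. \<Sum>q\<in>idx. F p q *v v)" for F
      by (simp add: sum_mult_vector)
    have "?S *v v = (\<Sum>p\<in>idx. \<Sum>q\<in>idx. (?c p q / 2 * Qform (e q) v) *s e p)
           - (\<Sum>p\<in>idx. \<Sum>q\<in>idx. (?c p q / 2 * Qform (e p) v) *s e q)"
      unfolding mv by (simp add: mscale_mult_vector wedge_mult_vector sum_subtractf)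
    also have "(\<Sum>p\<in>idx. \<Sum>q\<in>idx. (?c p q / 2 * Qform (e p) v) *s e q) =
               (\<Sum>q\<in>idx. \<Sum>p\<in>idx. (?c p q / 2 * Qform (e p) v) *s e q)"
      by (rule sum.swap)
    also have "\<dots> = - (\<Sum>q\<in>idx. \<Sum>p\<in>idx. (?c q p / 2 * Qform (e p) v) *s e q)"
      unfolding sum_negf[symmetric] by (intro sum.cong refl) (subst skew, simp)
    finally have "?S *v v = (\<Sum>p\<in>idx. \<Sum>q\<in>idx. (?c p q * Qform (e q) v) *s e p)"
      by (simp add: sum.distrib[symmetric] vec.scale_left_distrib[symmetric] mult.commute)
    also have "\<dots> = (\<Sum>p\<in>idx. (\<Sum>q\<in>idx. ?c p q * Qform (e q) v) *s e p)"
      by (simp add: vec.scale_sum_left)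
    also have "\<dots> = (\<Sum>p\<in>idx. Qform (e (opp p)) (X *v v) *s e p)"
    proof (intro sum.cong refl)
      fix p
      have "X *v v = (\<Sum>q\<in>idx. Qform (e (opp q)) v *s (X *v e q))"
        by (subst expansion[of v]) (simp add: mult_vector_sum vector_scalar_commute)
      also have "\<dots> = (\<Sum>q\<in>idx. Qform (e q) v *s (X *v e (opp q)))"
        by (rule sum.reindex_bij_witness[of _ opp opp]) (auto simp only: opp_in opp_opp)
      finally show "(\<Sum>q\<in>idx. ?c p q * Qform (e q) v) *s e p = Qform (e (opp p)) (X *v v) *s e p"
        by (simp add: Qform_sum_right Qform_scale_right mult.commute)
    qed
    also have "\<dots> = X *v v" by (rule expansion[symmetric])
    finally show ?thesis .
  qed
  then show ?thesis by (simp add: matrix_eq)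
qed

text \<open>
  It makes \<open>E\<^sub>i\<close> skew, which is not visible in its definition by eigenvalues.
\<close>

lemma E_eq:
  assumes "i \<in> {1..n}"
  shows "E n e i = mscale \<i> (wedge (e i) (e (n + i)))" (is "_ = ?W")
  unfolding E_def idx_def[symmetric]
proof (rule the_equality)
  have W: "?W *v e p = (\<i> * (Qform (e (n+i)) (e p))) *s e i - (\<i> * Qform (e i) (e p)) *s e (n + i)" for p
    by (simp add: mscale_mult_vector wedge_mult_vector)
  have opp: "opp i = n + i" "opp (n + i) = i"
    using assms by (auto simp: opp_def idx_def)
  show W3: "?W *v e i = \<i> *s e i \<and> ?W *v e (n + i) = - \<i> *s e (n + i) \<and>
        (\<forall>j\<in>idx - {i, n + i}. ?W *v e j = 0)"
    unfolding W using assms by (auto simp: Qform_basis opp idx_def)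
  fix A
  assume A: "A *v e i = \<i> *s e i \<and> A *v e (n + i) = - \<i> *s e (n + i) \<and>
        (\<forall>j\<in>idx - {i, n + i}. A *v e j = 0)"
  show "A = ?W"
    using A W3 by (intro matrix_eq_on_basis) (metis Diff_iff empty_iff insert_iff)
qed

lemma E_in_soC: "i \<in> {1..n} \<Longrightarrow> E n e i \<in> soC"
  by (simp add: E_eq mscale_in_soC)

lemma tor_in_soC: "tor a \<in> soC"
  unfolding tor_def soC_span_wedges scaleR_eq_mscale
  by (intro cmat.span_sum cmat.span_scale) (simp add: E_in_soC flip: soC_span_wedges)

lemma E_eigen:
  assumes "i \<in> {1..n}" "p \<in> idx"
  shows "E n e i *v e p = (\<i> * (if p = i then 1 else if p = n + i then -1 else 0)) *s e p"
proof -
  have opp: "opp i = n + i" "opp (n + i) = i"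
    using assms by (auto simp: opp_def idx_def)
  have ii: "i \<in> idx" "n + i \<in> idx" using assms(1) by (auto simp: idx_def)
  show ?thesis
    using assms ii by (auto simp: E_eq mscale_mult_vector wedge_mult_vector Qform_basis opp)
qed

lemma tor_eigen:
  assumes "p \<in> idx"
  shows "tor a *v e p = (\<i> * of_real (lam a p)) *s e p"
proof -
  have "tor a *v e p = (\<Sum>j=1..n. of_real (a j) *s (E n e j *v e p))"
    by (simp add: tor_def sum_mult_vector scaleR_eq_mscale mscale_mult_vector)
  also have "\<dots> = (\<Sum>j=1..n. (of_real (a j) * (\<i> * (if p = j then 1 else if p = n + j then -1 else 0))) *s e p)"
    using E_eigen[OF _ assms] by (intro sum.cong refl) simp
  also have "\<dots> = (\<Sum>j=1..n. of_real (a j) * (\<i> * (if p = j then 1 else if p = n + j then -1 else 0))) *s e p"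
    by (simp add: vec.scale_sum_left)
  also have "(\<Sum>j=1..n. of_real (a j) * (\<i> * (if p = j then 1 else if p = n + j then -1 else 0))) = \<i> * of_real (lam a p)"
  proof -
    consider "p \<le> n" | "n < p" "p \<le> 2 * n" | "p = 2 * n + 1" using assms by (fastforce simp: idx_def)
    then show ?thesis
    proof cases
      case 1
      have "(\<Sum>j=1..n. of_real (a j) * (\<i> * (if p = j then 1 else if p = n + j then -1 else 0)))
         = (\<Sum>j=1..n. if p = j then of_real (a j) * \<i> else 0)"
        using 1 by (intro sum.cong refl) auto
      then show ?thesis using 1 assms by (simp add: lam_def idx_def)
    next
      case 2
      have "(\<Sum>j=1..n. of_real (a j) * (\<i> * (if p = j then 1 else if p = n + j then -1 else 0)))
         = (\<Sum>j=1..n. if p - n = j then - of_real (a j) * \<i> else 0)"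
        using 2 by (intro sum.cong refl) auto
      also have "\<dots> = - of_real (a (p - n)) * \<i>"
        by (subst sum.delta') (use 2 in auto)
      finally show ?thesis using 2 assms by (simp add: lam_def idx_def)
    next
      case 3
      then show ?thesis by (simp add: lam_def sum.neutral)
    qed
  qed
  finally show ?thesis .
qed

lemma torus_eq: "torus n e = range tor"
  by (auto simp: torus_def tor_def)

lemma tor_inj:
  assumes "tor a = tor b" "j \<in> {1..n}"
  shows "a j = b j"
proof -
  have j: "j \<in> idx" using assms(2) by (auto simp: idx_def)
  have "(\<i> * of_real (lam a j)) *s e j = (\<i> * of_real (lam b j)) *s e j"
    using tor_eigen[OF j] assms(1) by metis
  then have "lam a j = lam b j"
    using basis_nonzero[OF j] by simp
  then show ?thesis using assms by (simp add: lam_def)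
qed

lemma L_tor:
  assumes "i \<in> {1..n}"
  shows "L n e i (tor a) = \<i> * of_real (a i)"
  unfolding L_def tor_def[symmetric]
  by (rule the_equality) (use tor_inj[OF _ assms] in auto)

lemma tor_diff: "tor a - tor b = tor (\<lambda>j. a j - b j)"
  by (simp add: tor_def sum_subtractf scaleR_diff_left)

end

section \<open>Finite-dimensional representations of sl(2)\<close>

text \<open>
  The operators of a representation on \<open>V\<close> are constrained only on \<open>V\<close>, so linearity has to be relativised.
\<close>

definition linear_within :: "(complex \<Rightarrow> 'v::ab_group_add \<Rightarrow> 'v) \<Rightarrow> 'v set \<Rightarrow> ('v \<Rightarrow> 'v) \<Rightarrow> bool" where
  "linear_within smul V T \<longleftrightarrow> (\<forall>v\<in>V. T v \<in> V) \<and> (\<forall>v\<in>V. \<forall>w\<in>V. T (v + w) = T v + T w) \<and>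
     (\<forall>c. \<forall>v\<in>V. T (smul c v) = smul c (T v))"

locale finite_span = vector_space smul
  for smul :: "complex \<Rightarrow> 'v::ab_group_add \<Rightarrow> 'v" +
  fixes V B :: "'v set"
  assumes subspace_V: "subspace V" and finite_B: "finite B" and span_B: "span B = V"
begin

lemma linear_within_zero: "linear_within smul V T \<Longrightarrow> T 0 = 0"
  using subspace_0[OF subspace_V] unfolding linear_within_def by (metis scale_zero_left)

lemma linear_within_sum:
  assumes "linear_within smul V T" "\<And>j. j \<in> J \<Longrightarrow> w j \<in> V"
  shows "T (\<Sum>j\<in>J. w j) = (\<Sum>j\<in>J. T (w j))"
  using assms(2)
proof (induction J rule: infinite_finite_induct)
  case (insert j J)
  have "T (w j + (\<Sum>j\<in>J. w j)) = T (w j) + T (\<Sum>j\<in>J. w j)"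
    using assms(1) insert.prems subspace_sum[OF subspace_V, of J w]
    unfolding linear_within_def by (metis insertCI)
  then show ?case using insert by simp
qed (simp_all add: linear_within_zero[OF assms(1)])

lemma funpow_in: "linear_within smul V T \<Longrightarrow> v \<in> V \<Longrightarrow> (T ^^ j) v \<in> V"
  by (induction j) (auto simp: linear_within_def)

text \<open>
  Nonzero eigenvectors for distinct eigenvalues are independent, and a finitely spanned space has no
  infinite independent family. This stops the chains of raising and lowering operators.
\<close>

lemma eigenvectors_vanish:
  assumes T: "linear_within smul V T"
    and w: "\<And>j. w j \<in> V" "\<And>j. T (w j) = smul (c j) (w j)"
    and c: "inj (c :: nat \<Rightarrow> complex)"
  shows "\<exists>j. w j = 0"
proof (rule ccontr)
  assume "\<nexists>j. w j = 0"
  then have nz: "w j \<noteq> 0" for j by blast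
  have indep: "\<forall>j<N. a j = 0" if "(\<Sum>j<N. smul (a j) (w j)) = 0" for N a
    using that
  proof (induction N arbitrary: a)
    case (Suc N)
    have "0 = T (\<Sum>j<Suc N. smul (a j) (w j))"
      using Suc.prems linear_within_zero[OF T] by simp
    also have "\<dots> = (\<Sum>j<Suc N. T (smul (a j) (w j)))"
      by (rule linear_within_sum[OF T]) (use w subspace_scale[OF subspace_V] in blast)
    also have "\<dots> = (\<Sum>j<Suc N. smul (a j * c j) (w j))"
      using T w by (intro sum.cong refl) (simp add: linear_within_def)
    finally have 1: "(\<Sum>j<Suc N. smul (a j * c j) (w j)) = 0" by simp
    have "(\<Sum>j<Suc N. smul (c N * a j) (w j)) = smul (c N) (\<Sum>j<Suc N. smul (a j) (w j))"
      by (simp add: scale_sum_right scale_right_distrib)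
    then have 2: "(\<Sum>j<Suc N. smul (c N * a j) (w j)) = 0"
      using Suc.prems by simp
    have "(\<Sum>j<Suc N. smul (a j * (c j - c N)) (w j)) = 0"
      using 1 2 by (simp add: right_diff_distrib scale_left_diff_distrib sum_subtractf mult.commute[of "c N"])
    then have "(\<Sum>j<N. smul (a j * (c j - c N)) (w j)) = 0" by simp
    then have "\<forall>j<N. a j * (c j - c N) = 0" by (rule Suc.IH)
    then have *: "\<forall>j<N. a j = 0" using c by (metis inj_eq less_irrefl mult_eq_0_iff right_minus_eq)
    then have "smul (a N) (w N) = 0" using Suc.prems by simp
    then have "a N = 0" using nz by simp
    with * show ?case by (simp add: less_Suc_eq)
  qed simp
  have inj: "inj w"
  proof (rule injI)
    fix i j assume "w i = w j"
    then have "smul (c i) (w i) = smul (c j) (w i)" using w by metis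
    then show "i = j" using c nz by (simp add: inj_eq)
  qed
  let ?N = "Suc (card B)"
  have "independent (w ` {..<?N})"
  proof
    assume "dependent (w ` {..<?N})"
    then obtain u where u: "\<exists>v\<in>w ` {..<?N}. u v \<noteq> 0" "(\<Sum>v\<in>w ` {..<?N}. smul (u v) v) = 0"
      by (auto simp: dependent_finite)
    have "(\<Sum>j<?N. smul (u (w j)) (w j)) = 0"
      using u(2) sum.reindex[OF inj_on_subset[OF inj subset_UNIV], of "\<lambda>v. smul (u v) v" "{..<?N}"]
      by (simp only: o_def)
    from indep[OF this] u(1) show False by auto
  qed
  moreover have "w ` {..<?N} \<subseteq> span B" using w span_B by auto
  ultimately have "card (w ` {..<?N}) \<le> card B"
    using independent_span_bound[OF finite_B] by blast
  then show False using card_image[OF inj_on_subset[OF inj subset_UNIV], of "{..<?N}"] by simp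
qed

end

locale sl2_action = finite_span smul V B
  for smul :: "complex \<Rightarrow> 'v::ab_group_add \<Rightarrow> 'v" and V B :: "'v set" +
  fixes x y h :: "'v \<Rightarrow> 'v"
  assumes linear_x: "linear_within smul V x" and linear_y: "linear_within smul V y"
    and linear_h: "linear_within smul V h"
    and h_x: "v \<in> V \<Longrightarrow> h (x v) = x (h v) + smul 2 (x v)"
    and h_y: "v \<in> V \<Longrightarrow> h (y v) = y (h v) - smul 2 (y v)"
    and x_y: "v \<in> V \<Longrightarrow> x (y v) = y (x v) + h v"
begin

lemma h_x_power:
  assumes "v \<in> V" "h v = smul c v"
  shows "h ((x ^^ j) v) = smul (c + 2 * of_nat j) ((x ^^ j) v)"
proof (induction j)
  case (Suc j)
  have "h (x ((x ^^ j) v)) = smul (c + 2 * of_nat j) (x ((x ^^ j) v)) + smul 2 (x ((x ^^ j) v))"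
    using h_x[OF funpow_in[OF linear_x assms(1), of j]] Suc linear_x funpow_in[OF linear_x assms(1), of j]
    by (simp add: linear_within_def)
  moreover have "c + 2 * of_nat (Suc j) = (c + 2 * of_nat j) + 2" by simp
  ultimately show ?case by (simp only: scale_left_distrib funpow.simps comp_apply)
qed (simp add: assms)

lemma h_y_power:
  assumes "v \<in> V" "h v = smul c v"
  shows "h ((y ^^ j) v) = smul (c - 2 * of_nat j) ((y ^^ j) v)"
proof (induction j)
  case (Suc j)
  have "h (y ((y ^^ j) v)) = smul (c - 2 * of_nat j) (y ((y ^^ j) v)) - smul 2 (y ((y ^^ j) v))"
    using h_y[OF funpow_in[OF linear_y assms(1), of j]] Suc linear_y funpow_in[OF linear_y assms(1), of j]
    by (simp add: linear_within_def)
  moreover have "c - 2 * of_nat (Suc j) = (c - 2 * of_nat j) - 2" by simp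
  ultimately show ?case by (simp only: scale_left_diff_distrib funpow.simps comp_apply)
qed (simp add: assms)

lemma last_nonzero_power:
  fixes T :: "'v \<Rightarrow> 'v"
  assumes "v \<noteq> 0" "\<exists>j. (T ^^ j) v = 0"
  shows "\<exists>p. (T ^^ p) v \<noteq> 0 \<and> (T ^^ Suc p) v = 0"
  using assms(2)
proof (rule exE)
  fix j assume "(T ^^ j) v = 0"
  then show ?thesis
  proof (induction j)
    case 0
    then show ?case using assms(1) by simp
  next
    case (Suc j)
    then show ?case by blast
  qed
qed

lemma x_power_last:
  assumes "v \<in> V" "v \<noteq> 0" "h v = smul c v"
  shows "\<exists>p. (x ^^ p) v \<noteq> 0 \<and> (x ^^ Suc p) v = 0"
proof (rule last_nonzero_power[OF assms(2)])
  show "\<exists>j. (x ^^ j) v = 0"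
    by (rule eigenvectors_vanish[OF linear_h, where c = "\<lambda>j. c + 2 * of_nat j"])
       (use assms funpow_in[OF linear_x] h_x_power in \<open>auto simp: inj_def\<close>)
qed

lemma y_power_last:
  assumes "v \<in> V" "v \<noteq> 0" "h v = smul c v"
  shows "\<exists>p. (y ^^ p) v \<noteq> 0 \<and> (y ^^ Suc p) v = 0"
proof (rule last_nonzero_power[OF assms(2)])
  show "\<exists>j. (y ^^ j) v = 0"
    by (rule eigenvectors_vanish[OF linear_h, where c = "\<lambda>j. c - 2 * of_nat j"])
       (use assms funpow_in[OF linear_y] h_y_power in \<open>auto simp: inj_def\<close>)
qed

lemma x_y_power:
  assumes "v \<in> V" "h v = smul c v" "x v = 0"
  shows "x ((y ^^ Suc j) v) = smul (of_nat (Suc j) * (c - of_nat j)) ((y ^^ j) v)"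
proof (induction j)
  case 0
  have "y (x v) = 0" using assms(3) linear_within_zero[OF linear_y] by simp
  then show ?case using x_y[OF assms(1)] assms by simp
next
  case (Suc j)
  let ?u = "(y ^^ j) v"
  have u: "?u \<in> V" "y ?u \<in> V"
    using funpow_in[OF linear_y assms(1), of j] funpow_in[OF linear_y assms(1), of "Suc j"] by simp_all
  have "x (y (y ?u)) = y (x (y ?u)) + h (y ?u)"
    by (rule x_y[OF u(2)])
  also have "y (x (y ?u)) = smul (of_nat (Suc j) * (c - of_nat j)) (y ?u)"
    using Suc linear_y u(1) by (simp add: linear_within_def)
  also have "h (y ?u) = smul (c - 2 * of_nat (Suc j)) (y ?u)"
    using h_y_power[OF assms(1,2), of "Suc j"] by simp
  also have "smul (of_nat (Suc j) * (c - of_nat j)) (y ?u) + smul (c - 2 * of_nat (Suc j)) (y ?u)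
     = smul (of_nat (Suc (Suc j)) * (c - of_nat (Suc j))) (y ?u)"
  proof -
    have "of_nat (Suc (Suc j)) * (c - of_nat (Suc j)) =
        of_nat (Suc j) * (c - of_nat j) + (c - 2 * of_nat (Suc j))"
      by (simp add: algebra_simps)
    then show ?thesis by (simp only: scale_left_distrib)
  qed
  finally show ?case by simp
qed

text \<open>
  Raise \<open>v\<close> as far as possible, to a vector \<open>u\<close> killed by \<open>x\<close>. If \<open>y\<^sup>q u\<close> is the last nonzero vector of the
  lowering chain, then \<open>0 = x y\<^bsup>q+1\<^esup> u\<close> is \<open>(q + 1) (c + 2 p - q)\<close> times that vector, so the eigenvalue of \<open>u\<close>
  is \<open>q\<close>.
\<close>

lemma weight_string:
  assumes "v \<in> V" "v \<noteq> 0" "h v = smul c v"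
  shows "\<exists>p q. c + 2 * of_nat p = of_nat q \<and> (\<forall>j\<le>q. (y ^^ j) ((x ^^ p) v) \<noteq> 0)"
proof -
  obtain p where p: "(x ^^ p) v \<noteq> 0" "(x ^^ Suc p) v = 0"
    using x_power_last[OF assms] by blast
  let ?u = "(x ^^ p) v"
  have u: "?u \<in> V" "x ?u = 0" "h ?u = smul (c + 2 * of_nat p) ?u"
    using funpow_in[OF linear_x assms(1)] p h_x_power[OF assms(1,3)] by simp_all
  obtain q where q: "(y ^^ q) ?u \<noteq> 0" "(y ^^ Suc q) ?u = 0"
    using y_power_last[OF u(1) p(1) u(3)] by blast
  have "smul (of_nat (Suc q) * (c + 2 * of_nat p - of_nat q)) ((y ^^ q) ?u) = 0"
    using x_y_power[OF u(1,3,2), of q] q(2) linear_within_zero[OF linear_x] by simp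
  then have "c + 2 * of_nat p = of_nat q"
    using q(1) by (simp del: of_nat_Suc)
  moreover have "(y ^^ j) ?u \<noteq> 0" if "j \<le> q" for j
  proof
    assume "(y ^^ j) ?u = 0"
    then have "(y ^^ (q - j)) ((y ^^ j) ?u) = 0"
    proof -
      have "(y ^^ i) 0 = 0" for i
        by (induction i) (simp_all add: linear_within_zero[OF linear_y])
      then show ?thesis using \<open>(y ^^ j) ?u = 0\<close> by simp
    qed
    then show False using q(1) that by (simp flip: funpow_add comp_apply[of "y ^^ (q-j)"])
  qed
  ultimately show ?thesis by blast
qed

text \<open>
  The automorphism of \<open>sl(2)\<close> that exchanges raising and lowering.
\<close>

lemma opposite: "sl2_action smul V B y x (\<lambda>v. - h v)"
proof
  have "linear_within smul V (\<lambda>v. - h v)"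
    using linear_h subspace_neg[OF subspace_V]
    by (simp add: linear_within_def scale_minus_right)
  then show "linear_within smul V (\<lambda>v. - h v)" .
  have neg: "T (- v) = - T v" if "linear_within smul V T" "v \<in> V" for T v
  proof -
    have "T (smul (-1) v) = smul (-1) (T v)"
      using that unfolding linear_within_def by blast
    then show ?thesis by simp
  qed
  have hV: "h v \<in> V" if "v \<in> V" for v using that linear_h by (simp add: linear_within_def)
  show "- h (y v) = y (- h v) + smul 2 (y v)" if "v \<in> V" for v
    using h_y[OF that] neg[OF linear_y hV[OF that]] by simp
  show "- h (x v) = x (- h v) - smul 2 (x v)" if "v \<in> V" for v
    using h_x[OF that] neg[OF linear_x hV[OF that]] by simp
  show "y (x v) = x (y v) + - h v" if "v \<in> V" for v
    using x_y[OF that] by simp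
qed (fact linear_y linear_x)+

text \<open>
  For \<open>c = k \<ge> 0\<close> the eigenvalue \<open>-k\<close> lies on the string through \<open>v\<close>: go up \<open>p\<close> steps to the top and then down
  \<open>k + p\<close> steps. For \<open>c \<le> 0\<close> exchange the roles of \<open>x\<close> and \<open>y\<close>. Writing the vector through powers of \<open>x\<close> and \<open>y\<close>
  keeps track of its weight under the whole torus.
\<close>

lemma reflected_vector:
  assumes "v \<in> V" "v \<noteq> 0" "h v = smul c v"
  shows "(\<exists>k p. c = of_nat k \<and> (y ^^ (k + p)) ((x ^^ p) v) \<noteq> 0) \<or>
         (\<exists>k p. c = - of_nat k \<and> (x ^^ (k + p)) ((y ^^ p) v) \<noteq> 0)"
proof -
  obtain p q where pq: "c + 2 * of_nat p = of_nat q" "\<forall>j\<le>q. (y ^^ j) ((x ^^ p) v) \<noteq> 0"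
    using weight_string[OF assms] by blast
  show ?thesis
  proof (cases "2 * p \<le> q")
    case True
    then obtain k where k: "q = k + 2 * p" by (metis add.commute le_Suc_ex)
    then have "c = of_nat k" "(y ^^ (k + p)) ((x ^^ p) v) \<noteq> 0"
      using pq by (auto simp: algebra_simps)
    then show ?thesis by blast
  next
    case False
    then obtain k where k: "2 * p = q + k" by (metis le_Suc_ex nat_le_linear)
    have "of_nat (2 * p) = (of_nat (q + k) :: complex)" by (simp only: k)
    then have c: "c = - of_nat k"
      using pq(1) by (simp add: algebra_simps add_eq_0_iff)
    interpret opp: sl2_action smul V B y x "\<lambda>v. - h v" by (rule opposite)
    obtain p' q' where pq': "of_nat k + 2 * of_nat p' = (of_nat q' :: complex)"
      "\<forall>j\<le>q'. (x ^^ j) ((y ^^ p') v) \<noteq> 0"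
      using opp.weight_string[OF assms(1,2), of "of_nat k"] assms(3) c by auto
    have "of_nat (k + 2 * p') = (of_nat q' :: complex)" using pq'(1) by simp
    then have "k + 2 * p' = q'" by (simp only: of_nat_eq_iff)
    then have "(x ^^ (k + p')) ((y ^^ p') v) \<noteq> 0" using pq'(2) by auto
    then show ?thesis using c by blast
  qed
qed

end

section \<open>Symmetry of the weights and the uniton number\<close>

context
  fixes smul :: "complex \<Rightarrow> 'v::ab_group_add \<Rightarrow> 'v" and V :: "'v set"
    and \<rho> :: "complex^'d^'d \<Rightarrow> 'v \<Rightarrow> 'v"
  assumes rep: "representation smul V \<rho>"
begin

lemma rep_finite_span: "\<exists>B. finite_span smul V B"
  using rep unfolding representation_def finite_span_def finite_span_axioms_def
    module_iff_vector_space by blast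

lemma rep_linear: "X \<in> soC \<Longrightarrow> linear_within smul V (\<rho> X)"
  using rep unfolding representation_def linear_within_def by blast

lemma rep_add: "X \<in> soC \<Longrightarrow> Y \<in> soC \<Longrightarrow> v \<in> V \<Longrightarrow> \<rho> (X + Y) v = \<rho> X v + \<rho> Y v"
  using rep unfolding representation_def by blast

lemma rep_mscale: "X \<in> soC \<Longrightarrow> v \<in> V \<Longrightarrow> \<rho> (mscale c X) v = smul c (\<rho> X v)"
  using rep unfolding representation_def by blast

lemma rep_bracket:
  "X \<in> soC \<Longrightarrow> Y \<in> soC \<Longrightarrow> v \<in> V \<Longrightarrow> \<rho> (bracket X Y) v = \<rho> X (\<rho> Y v) - \<rho> Y (\<rho> X v)"
  using rep unfolding representation_def by blast

lemma rep_commute: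
  assumes "X \<in> soC" "Y \<in> soC" "v \<in> V" "bracket X Y = mscale d Y"
  shows "\<rho> X (\<rho> Y v) = \<rho> Y (\<rho> X v) + smul d (\<rho> Y v)"
  using rep_bracket[OF assms(1-3)] rep_mscale[OF assms(2,3), of d] assms(4)
  by (simp add: algebra_simps)

lemma rep_shift:
  assumes "X \<in> soC" "Y \<in> soC" "v \<in> V" "bracket X Y = mscale d Y" "\<rho> X v = smul c v"
  shows "\<rho> X ((\<rho> Y ^^ j) v) = smul (c + of_nat j * d) ((\<rho> Y ^^ j) v)"
proof (induction j)
  case 0
  then show ?case by (simp add: assms)
next
  case (Suc j)
  obtain B where "finite_span smul V B" using rep_finite_span by blast
  then interpret finite_span smul V B .
  let ?u = "(\<rho> Y ^^ j) v"
  have u: "?u \<in> V" by (rule funpow_in[OF rep_linear[OF assms(2)] assms(3)])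
  have "\<rho> X (\<rho> Y ?u) = \<rho> Y (\<rho> X ?u) + smul d (\<rho> Y ?u)"
    by (rule rep_commute[OF assms(1,2) u assms(4)])
  also have "\<rho> Y (\<rho> X ?u) = smul (c + of_nat j * d) (\<rho> Y ?u)"
    using rep_linear[OF assms(2)] u Suc by (simp add: linear_within_def)
  also have "smul (c + of_nat j * d) (\<rho> Y ?u) + smul d (\<rho> Y ?u) = smul ((c + of_nat j * d) + d) (\<rho> Y ?u)"
    by (simp only: scale_left_distrib)
  also have "(c + of_nat j * d) + d = c + of_nat (Suc j) * d"
    by (simp add: algebra_simps)
  finally show ?case by simp
qed

end

context adapted
begin

text \<open>
  A weight is a linear functional on the torus, so it is recorded by its coordinates \<open>x\<close> with respect to
  \<open>L\<^sub>1, \<dots>, L\<^sub>n\<close>; \<open>pairing b x\<close> is its value at \<open>tor b\<close>.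
\<close>

definition pairing :: "(nat \<Rightarrow> real) \<Rightarrow> (nat \<Rightarrow> complex) \<Rightarrow> complex" where
  "pairing b x = (\<Sum>j=1..n. \<i> * of_real (b j) * x j)"

definition weight_vector :: "(complex \<Rightarrow> 'v::ab_group_add \<Rightarrow> 'v) \<Rightarrow> 'v set \<Rightarrow> (complex^'d^'d \<Rightarrow> 'v \<Rightarrow> 'v) \<Rightarrow>
    (nat \<Rightarrow> complex) \<Rightarrow> 'v \<Rightarrow> bool" where
  "weight_vector smul V \<rho> x v \<longleftrightarrow> v \<in> V \<and> v \<noteq> 0 \<and> (\<forall>b. \<rho> (tor b) v = smul (pairing b x) v)"

lemma E_eq_tor: "i \<in> {1..n} \<Longrightarrow> E n e i = tor (\<lambda>j. if j = i then 1 else 0)"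
  by (simp add: tor_def if_distrib[of "\<lambda>r. r *\<^sub>R _"] cong: if_cong)

lemma pairing_uminus: "pairing b (\<lambda>j. - x j) = - pairing b x"
  by (simp add: pairing_def sum_negf)

lemma pairing_update:
  "i \<in> {1..n} \<Longrightarrow> pairing b (x(i := y)) = pairing b x + \<i> * of_real (b i) * (y - x i)"
  by (simp add: pairing_def sum.remove[of _ i] algebra_simps)

lemma pairing_unit: "i \<in> {1..n} \<Longrightarrow> pairing (\<lambda>j. if j = i then 1 else 0) x = \<i> * x i"
proof -
  assume "i \<in> {1..n}"
  moreover have "pairing (\<lambda>j. if j = i then 1 else 0) x = (\<Sum>j=1..n. if j = i then \<i> * x i else 0)"
    unfolding pairing_def by (intro sum.cong refl) simp
  ultimately show ?thesis by simp
qed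

definition mid :: nat where
  "mid = 2 * n + 1"

lemma lam_mid: "lam b mid = 0"
  by (simp add: mid_def lam_def)

lemma idx_cases:
  assumes "p \<in> idx"
  obtains "p \<in> {1..n}" | "p - n \<in> {1..n}" "n < p" "p \<le> 2 * n" | "p = mid"
  using assms by (fastforce simp: idx_def mid_def)

lemma tor_mult_basis: 
  assumes "i \<in> {1..n}"
  shows "tor b *v e i = (\<i> * of_real (b i)) *s e i"
    and "tor b *v e (n + i) = (- (\<i> * of_real (b i))) *s e (n + i)"
    and "tor b *v e mid = 0"
proof -
  have "i \<in> idx" "n + i \<in> idx" "mid \<in> idx" using assms by (auto simp: idx_def mid_def)
  then show "tor b *v e i = (\<i> * of_real (b i)) *s e i"
    and "tor b *v e (n + i) = (- (\<i> * of_real (b i))) *s e (n + i)"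
    and "tor b *v e mid = 0"
    using tor_eigen[of i b] tor_eigen[of "n + i" b] tor_eigen[of mid b] assms
    by (auto simp: lam_def mid_def)
qed

text \<open>
  Root vectors for the short roots \<open>L\<^sub>i\<close> and \<open>-L\<^sub>i\<close>. The factor \<open>-2\<close> makes their bracket the coroot
  \<open>-2 \<i> E\<^sub>i\<close>, on which \<open>L\<^sub>i\<close> takes the value \<open>2\<close>, as the relations of \<open>sl(2)\<close> require.
\<close>

definition raise :: "nat \<Rightarrow> complex^'d^'d" where
  "raise i = wedge (e i) (e mid)"

definition lower :: "nat \<Rightarrow> complex^'d^'d" where
  "lower i = mscale (-2) (wedge (e (n + i)) (e mid))"

lemma raise_in_soC: "raise i \<in> soC" and lower_in_soC: "lower i \<in> soC"
  unfolding raise_def lower_def by (intro mscale_in_soC wedge_in_soC)+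

lemma bracket_tor_raise:
  "i \<in> {1..n} \<Longrightarrow> bracket (tor b) (raise i) = mscale (\<i> * of_real (b i)) (raise i)"
  by (simp add: raise_def bracket_wedge tor_in_soC tor_mult_basis wedge_scale_left)

lemma bracket_tor_lower:
  "i \<in> {1..n} \<Longrightarrow> bracket (tor b) (lower i) = mscale (- (\<i> * of_real (b i))) (lower i)"
  by (simp only: lower_def bracket_mscale_right bracket_wedge[OF tor_in_soC] tor_mult_basis
      wedge_scale_left wedge_zero add_0_right mscale_mscale mult.commute)

lemma bracket_raise_lower:
  assumes "i \<in> {1..n}"
  shows "bracket (raise i) (lower i) = mscale (- 2 * \<i>) (E n e i)"
proof -
  have I: "i \<in> idx" "n + i \<in> idx" "mid \<in> idx" using assms by (auto simp: idx_def mid_def)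
  have opp: "opp i = n + i" "opp (n + i) = i" "opp mid = mid"
    using assms by (auto simp: opp_def idx_def mid_def)
  have ne: "n + i \<noteq> mid" "i \<noteq> mid" "mid \<noteq> n + i" using assms by (auto simp: mid_def)
  have 1: "raise i *v e (n + i) = (-1) *s e mid" "raise i *v e mid = e i"
    using assms ne by (auto simp: raise_def wedge_mult_vector Qform_basis I opp)
  have "wedge (e (n + i)) (e i) = mscale (-1) (wedge (e i) (e (n + i)))"
    by (simp add: wedge_def mscale_def vec_eq_iff)
  then have "bracket (raise i) (lower i) = mscale 2 (wedge (e i) (e (n + i)))"
    unfolding lower_def bracket_mscale_right bracket_wedge[OF raise_in_soC] 1 wedge_scale_left wedge_self
    by (simp add: mscale_mscale)
  moreover have "- 2 * \<i> * \<i> = 2" by (simp add: mult.assoc)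
  ultimately show ?thesis by (simp only: E_eq[OF assms] mscale_mscale)
qed

text \<open>
  The coroot acts on \<open>v\<close> by \<open>2 x\<^sub>i\<close>, which is an integer \<open>k\<close> up to sign. Moving by \<open>k\<close> steps of \<open>L\<^sub>i\<close> changes the
  \<open>i\<close>-th coordinate from \<open>x\<^sub>i\<close> to \<open>x\<^sub>i - 2 x\<^sub>i\<close> and leaves the others alone.
\<close>

lemma weight_vector_reflect:
  fixes smul :: "complex \<Rightarrow> 'v::ab_group_add \<Rightarrow> 'v" and \<rho> :: "complex^'d^'d \<Rightarrow> 'v \<Rightarrow> 'v"
  assumes rep: "representation smul V \<rho>" and v: "weight_vector smul V \<rho> x v" and i: "i \<in> {1..n}"
  shows "\<exists>w. weight_vector smul V \<rho> (x(i := - x i)) w"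
proof -
  obtain B where "finite_span smul V B" using rep_finite_span[OF rep] by blast
  then interpret finite_span smul V B .
  let ?h = "mscale (- 2 * \<i>) (E n e i)"
  have h: "?h \<in> soC" by (rule mscale_in_soC[OF E_in_soC[OF i]])
  have br: "bracket ?h (raise i) = mscale 2 (raise i)" "bracket ?h (lower i) = mscale (- 2) (lower i)"
  proof -
    have "- 2 * \<i> * \<i> = 2" "- 2 * \<i> * - \<i> = - 2" by (simp_all add: mult.assoc)
    then show "bracket ?h (raise i) = mscale 2 (raise i)" "bracket ?h (lower i) = mscale (- 2) (lower i)"
      unfolding E_eq_tor[OF i] bracket_mscale_left bracket_tor_raise[OF i] bracket_tor_lower[OF i] mscale_mscale
      by (simp_all only: if_True refl of_real_1 mult_1_right)
  qed
  interpret sl2_action smul V B "\<rho> (raise i)" "\<rho> (lower i)" "\<rho> ?h"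
  proof
    fix v assume "v \<in> V"
    then show "\<rho> ?h (\<rho> (raise i) v) = \<rho> (raise i) (\<rho> ?h v) + smul 2 (\<rho> (raise i) v)"
      by (rule rep_commute[OF rep h raise_in_soC _ br(1)])
    show "\<rho> ?h (\<rho> (lower i) v) = \<rho> (lower i) (\<rho> ?h v) - smul 2 (\<rho> (lower i) v)"
      using rep_commute[OF rep h lower_in_soC \<open>v \<in> V\<close> br(2)] by simp
    show "\<rho> (raise i) (\<rho> (lower i) v) = \<rho> (lower i) (\<rho> (raise i) v) + \<rho> ?h v"
      using rep_bracket[OF rep raise_in_soC lower_in_soC \<open>v \<in> V\<close>, of i i] bracket_raise_lower[OF i]
      by (simp add: algebra_simps)
  qed (intro rep_linear[OF rep] raise_in_soC lower_in_soC h)+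
  have vV: "v \<in> V" "v \<noteq> 0" and wt: "\<And>b. \<rho> (tor b) v = smul (pairing b x) v"
    using v by (auto simp: weight_vector_def)
  have hv: "\<rho> ?h v = smul (2 * x i) v"
  proof -
    have eq: "- 2 * \<i> * (\<i> * x i) = 2 * x i" by (simp flip: mult.assoc)
    show ?thesis
      unfolding rep_mscale[OF rep E_in_soC[OF i] vV(1)]
      unfolding E_eq_tor[OF i] wt pairing_unit[OF i] scale_scale eq by (rule refl)
  qed
  consider k p where "2 * x i = of_nat k" "(\<rho> (lower i) ^^ (k + p)) ((\<rho> (raise i) ^^ p) v) \<noteq> 0"
    | k p where "2 * x i = - of_nat k" "(\<rho> (raise i) ^^ (k + p)) ((\<rho> (lower i) ^^ p) v) \<noteq> 0"
    using reflected_vector[OF vV hv] by blast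
  then show ?thesis
  proof cases
    case 1
    let ?u = "(\<rho> (raise i) ^^ p) v"
    let ?w = "(\<rho> (lower i) ^^ (k + p)) ?u"
    have u: "?u \<in> V" by (rule funpow_in[OF linear_x vV(1)])
    have "\<rho> (tor b) ?w = smul (pairing b (x(i := - x i))) ?w" for b
    proof -
      have eq: "pairing b x + of_nat p * (\<i> * of_real (b i)) + of_nat (k + p) * (- (\<i> * of_real (b i)))
          = pairing b (x(i := - x i))"
        using 1(1) by (simp add: pairing_update[OF i] algebra_simps)
      show ?thesis
        using rep_shift[OF rep tor_in_soC lower_in_soC u bracket_tor_lower[OF i, of b]
            rep_shift[OF rep tor_in_soC raise_in_soC vV(1) bracket_tor_raise[OF i] wt, where j = p], where j = "k + p"]
        unfolding eq .
    qed
    then show ?thesis using funpow_in[OF linear_y u] 1(2) unfolding weight_vector_def by blast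
  next
    case 2
    let ?u = "(\<rho> (lower i) ^^ p) v"
    let ?w = "(\<rho> (raise i) ^^ (k + p)) ?u"
    have u: "?u \<in> V" by (rule funpow_in[OF linear_y vV(1)])
    have "\<rho> (tor b) ?w = smul (pairing b (x(i := - x i))) ?w" for b
    proof -
      have "of_nat k = - (2 * x i)" using 2(1) by simp
      then have eq: "pairing b x + of_nat p * (- (\<i> * of_real (b i))) + of_nat (k + p) * (\<i> * of_real (b i))
          = pairing b (x(i := - x i))"
        by (simp add: pairing_update[OF i] algebra_simps)
      show ?thesis
        using rep_shift[OF rep tor_in_soC raise_in_soC u bracket_tor_raise[OF i, of b]
            rep_shift[OF rep tor_in_soC lower_in_soC vV(1) bracket_tor_lower[OF i] wt, where j = p], where j = "k + p"]
        unfolding eq .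
    qed
    then show ?thesis using funpow_in[OF linear_x u] 2(2) unfolding weight_vector_def by blast
  qed
qed

text \<open>
  Apply the reflections in \<open>L\<^sub>1, \<dots>, L\<^sub>n\<close> one after the other.
\<close>

lemma weight_vector_uminus:
  fixes smul :: "complex \<Rightarrow> 'v::ab_group_add \<Rightarrow> 'v" and \<rho> :: "complex^'d^'d \<Rightarrow> 'v \<Rightarrow> 'v"
  assumes rep: "representation smul V \<rho>" and v: "weight_vector smul V \<rho> x v"
  shows "\<exists>w. weight_vector smul V \<rho> (\<lambda>j. - x j) w"
proof -
  have "\<exists>w. weight_vector smul V \<rho> (\<lambda>j. if j \<le> m then - x j else x j) w" if "m \<le> n" for m
    using that
  proof (induction m)
    case 0
    have "pairing b (\<lambda>j. if j \<le> 0 then - x j else x j) = pairing b x" for b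
      unfolding pairing_def by (intro sum.cong refl) simp
    then show ?case using v unfolding weight_vector_def by metis
  next
    case (Suc m)
    let ?x = "\<lambda>j. if j \<le> m then - x j else x j"
    obtain w where "weight_vector smul V \<rho> ?x w" using Suc by auto
    then obtain w' where "weight_vector smul V \<rho> (?x(Suc m := - ?x (Suc m))) w'"
      using weight_vector_reflect[OF rep, of ?x w "Suc m"] Suc.prems by auto
    moreover have "?x(Suc m := - ?x (Suc m)) = (\<lambda>j. if j \<le> Suc m then - x j else x j)"
      by auto
    ultimately show ?case by metis
  qed
  then obtain w where w: "weight_vector smul V \<rho> (\<lambda>j. if j \<le> n then - x j else x j) w" by blast
  have "pairing b (\<lambda>j. if j \<le> n then - x j else x j) = pairing b (\<lambda>j. - x j)" for b
    unfolding pairing_def by (intro sum.cong refl) simp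
  then have "weight_vector smul V \<rho> (\<lambda>j. - x j) w" using w unfolding weight_vector_def by simp
  then show ?thesis ..
qed

lemma rep_tor:
  fixes smul :: "complex \<Rightarrow> 'v::ab_group_add \<Rightarrow> 'v" and \<rho> :: "complex^'d^'d \<Rightarrow> 'v \<Rightarrow> 'v"
  assumes rep: "representation smul V \<rho>" and v: "v \<in> V"
  shows "\<rho> (tor b) v = (\<Sum>j=1..n. smul (of_real (b j)) (\<rho> (E n e j) v))"
proof -
  obtain B where "finite_span smul V B" using rep_finite_span[OF rep] by blast
  then interpret finite_span smul V B .
  have "(\<Sum>j\<in>J. b j *\<^sub>R E n e j) \<in> soC \<and>
        \<rho> (\<Sum>j\<in>J. b j *\<^sub>R E n e j) v = (\<Sum>j\<in>J. smul (of_real (b j)) (\<rho> (E n e j) v))"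
    if "finite J" "J \<subseteq> {1..n}" for J
    using that
  proof (induction J rule: finite_induct)
    case empty
    have "\<rho> (mscale 0 0) v = smul 0 (\<rho> 0 v)" by (rule rep_mscale[OF rep zero_in_soC v])
    then show ?case by (simp add: zero_in_soC)
  next
    case (insert j J)
    have E: "E n e j \<in> soC" using insert.prems E_in_soC by auto
    have "b j *\<^sub>R E n e j \<in> soC" "\<rho> (b j *\<^sub>R E n e j) v = smul (of_real (b j)) (\<rho> (E n e j) v)"
      unfolding scaleR_eq_mscale using mscale_in_soC[OF E] rep_mscale[OF rep E v] by auto
    moreover have "(\<Sum>j\<in>J. b j *\<^sub>R E n e j) \<in> soC"
      "\<rho> (\<Sum>j\<in>J. b j *\<^sub>R E n e j) v = (\<Sum>j\<in>J. smul (of_real (b j)) (\<rho> (E n e j) v))"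
      using insert by auto
    ultimately show ?case
      using add_in_soC rep_add[OF rep _ _ v] by (simp only: sum.insert[OF insert.hyps] simp_thms)
  qed
  then show ?thesis unfolding tor_def by blast
qed

text \<open>
  A representation is linear on the torus, so each of its weights is a linear functional there and has
  coordinates.
\<close>

lemma weight_imp_weight_vector:
  fixes smul :: "complex \<Rightarrow> 'v::ab_group_add \<Rightarrow> 'v" and \<rho> :: "complex^'d^'d \<Rightarrow> 'v \<Rightarrow> 'v"
  assumes rep: "representation smul V \<rho>" and \<mu>: "weight n e smul V \<rho> \<mu>"
  shows "\<exists>x v. weight_vector smul V \<rho> x v \<and> (\<forall>b. \<mu> (tor b) = pairing b x)"
proof -
  obtain B where "finite_span smul V B" using rep_finite_span[OF rep] by blast
  then interpret finite_span smul V B .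
  obtain v where v: "v \<in> V" "v \<noteq> 0" and wt: "\<And>b. \<rho> (tor b) v = smul (\<mu> (tor b)) v"
    using \<mu> unfolding weight_def torus_eq by blast
  define x where "x j = - \<i> * \<mu> (E n e j)" for j
  have "smul (\<mu> (tor b)) v = smul (pairing b x) v" for b
  proof -
    have "smul (\<mu> (tor b)) v = (\<Sum>j=1..n. smul (of_real (b j)) (\<rho> (E n e j) v))"
      using rep_tor[OF rep v(1), of b] wt by simp
    also have "\<dots> = (\<Sum>j=1..n. smul (of_real (b j) * \<mu> (E n e j)) v)"
      using wt by (intro sum.cong refl) (simp add: E_eq_tor)
    also have "\<dots> = smul (\<Sum>j=1..n. of_real (b j) * \<mu> (E n e j)) v"
      by (rule scale_sum_left[symmetric])
    also have "(\<Sum>j=1..n. of_real (b j) * \<mu> (E n e j)) = pairing b x"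
      unfolding pairing_def x_def by (intro sum.cong refl) (simp add: algebra_simps)
    finally show ?thesis .
  qed
  then have "\<mu> (tor b) = pairing b x" for b using v by simp
  then show ?thesis using v wt unfolding weight_vector_def by metis
qed

lemma weight_uminus:
  fixes smul :: "complex \<Rightarrow> 'v::ab_group_add \<Rightarrow> 'v" and \<rho> :: "complex^'d^'d \<Rightarrow> 'v \<Rightarrow> 'v"
  assumes rep: "representation smul V \<rho>" and \<mu>: "weight n e smul V \<rho> \<mu>"
  shows "weight n e smul V \<rho> (\<lambda>\<eta>. - \<mu> \<eta>)"
proof -
  obtain x v where x: "weight_vector smul V \<rho> x v" "\<And>b. \<mu> (tor b) = pairing b x"
    using weight_imp_weight_vector[OF assms] by blast
  obtain w where "weight_vector smul V \<rho> (\<lambda>j. - x j) w"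
    using weight_vector_uminus[OF rep x(1)] by blast
  then show ?thesis
    unfolding weight_def weight_vector_def torus_eq by (auto simp: pairing_uminus x(2))
qed

lemma simple_root_tor:
  "i \<in> {1..n} \<Longrightarrow> simple_root n e i (tor b) = \<i> * (of_real (b i) - (if i < n then of_real (b (i + 1)) else 0))"
  by (auto simp: simple_root_def L_tor algebra_simps)

text \<open>
  If both differences are nonnegative combinations of simple roots, their sum vanishes. Evaluate it at
  an element of the torus on which all simple roots take the value \<open>\<i>\<close>: every coefficient must be zero.
\<close>

lemma weight_le_antisym:
  assumes "weight_le n e \<mu> \<nu>" "weight_le n e \<nu> \<mu>" "\<eta> \<in> torus n e"
  shows "\<mu> \<eta> = \<nu> \<eta>"
proof -
  obtain c c' :: "nat \<Rightarrow> nat"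
    where c: "\<And>\<eta>. \<eta> \<in> torus n e \<Longrightarrow> \<nu> \<eta> - \<mu> \<eta> = (\<Sum>i=1..n. of_nat (c i) * simple_root n e i \<eta>)"
      and c': "\<And>\<eta>. \<eta> \<in> torus n e \<Longrightarrow> \<mu> \<eta> - \<nu> \<eta> = (\<Sum>i=1..n. of_nat (c' i) * simple_root n e i \<eta>)"
    using assms(1,2) unfolding weight_le_def by blast
  \<comment> \<open>\<open>H\<^sub>1 + \<dots> + H\<^sub>n\<close>\<close>
  define \<delta> where "\<delta> = tor (\<lambda>j. real (n + 1 - j))"
  have \<delta>: "\<delta> \<in> torus n e" by (auto simp: \<delta>_def torus_eq)
  have root: "simple_root n e i \<delta> = \<i>" if "i \<in> {1..n}" for i
  proof -
    have "n + 1 - i = Suc (n - i)" using that by auto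
    then have "complex_of_real (real (n + 1 - i)) - (if i < n then of_real (real (n + 1 - (i + 1))) else 0) = 1"
      using that by auto
    then show ?thesis unfolding \<delta>_def simple_root_tor[OF that] by simp
  qed
  have "0 = (\<nu> \<delta> - \<mu> \<delta>) + (\<mu> \<delta> - \<nu> \<delta>)" by simp
  also have "\<dots> = (\<Sum>i=1..n. of_nat (c i + c' i) * \<i>)"
    unfolding c[OF \<delta>] c'[OF \<delta>] sum.distrib[symmetric]
    by (intro sum.cong refl) (simp add: root algebra_simps)
  also have "\<dots> = of_nat (\<Sum>i=1..n. c i + c' i) * \<i>"
    by (simp only: sum_distrib_right of_nat_sum)
  finally have "(\<Sum>i=1..n. c i + c' i) = 0" by (simp del: of_nat_sum of_nat_add)
  then have "c i = 0" if "i \<in> {1..n}" for i using that by simp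
  then have "\<nu> \<eta> - \<mu> \<eta> = 0" using c[OF assms(3)] by simp
  then show ?thesis by simp
qed

text \<open>
  Negation permutes the weights and reverses their order.
\<close>

lemma lowest_weight_uminus:
  fixes smul :: "complex \<Rightarrow> 'v::ab_group_add \<Rightarrow> 'v" and \<rho> :: "complex^'d^'d \<Rightarrow> 'v \<Rightarrow> 'v"
  assumes rep: "representation smul V \<rho>" and \<omega>: "highest_weight n e smul V \<rho> \<omega>"
  shows "lowest_weight n e smul V \<rho> (\<lambda>\<eta>. - \<omega> \<eta>)"
  unfolding lowest_weight_def
proof (intro conjI allI impI)
  show "weight n e smul V \<rho> (\<lambda>\<eta>. - \<omega> \<eta>)"
    using \<omega> weight_uminus[OF rep] by (simp add: highest_weight_def)
  fix \<nu> assume "weight n e smul V \<rho> \<nu>"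
  then have "weight_le n e (\<lambda>\<eta>. - \<nu> \<eta>) \<omega>"
    using \<omega> weight_uminus[OF rep] by (simp add: highest_weight_def)
  then show "weight_le n e (\<lambda>\<eta>. - \<omega> \<eta>) \<nu>"
    by (simp add: weight_le_def add.commute)
qed

lemma uniton_number_eq:
  fixes smul :: "complex \<Rightarrow> 'v::ab_group_add \<Rightarrow> 'v" and \<rho> :: "complex^'d^'d \<Rightarrow> 'v \<Rightarrow> 'v"
  assumes rep: "representation smul V \<rho>" and \<omega>: "highest_weight n e smul V \<rho> \<omega>"
    and r: "\<omega> (tor b) = \<i> * of_real r"
  shows "uniton_number n e smul V \<rho> (tor b) = 2 * r"
  unfolding uniton_number_def
proof (rule the_equality)
  have t: "tor b \<in> torus n e" by (simp add: torus_eq)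
  note low = lowest_weight_uminus[OF rep \<omega>]
  show "\<exists>\<omega> \<phi>. highest_weight n e smul V \<rho> \<omega> \<and> lowest_weight n e smul V \<rho> \<phi> \<and>
        complex_of_real (2 * r) = (1 / \<i>) * (\<omega> (tor b) - \<phi> (tor b))"
    using \<omega> low r by (intro exI[of _ \<omega>] exI[of _ "\<lambda>\<eta>. - \<omega> \<eta>"]) simp
  fix s assume "\<exists>\<omega> \<phi>. highest_weight n e smul V \<rho> \<omega> \<and> lowest_weight n e smul V \<rho> \<phi> \<and>
        complex_of_real s = (1 / \<i>) * (\<omega> (tor b) - \<phi> (tor b))"
  then obtain \<omega>' \<phi>' where h: "highest_weight n e smul V \<rho> \<omega>'" "lowest_weight n e smul V \<rho> \<phi>'"
    and s: "complex_of_real s = (1 / \<i>) * (\<omega>' (tor b) - \<phi>' (tor b))" by blast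
  have "\<omega>' (tor b) = \<omega> (tor b)"
    using h(1) \<omega> by (intro weight_le_antisym[OF _ _ t]) (auto simp: highest_weight_def)
  moreover have "\<phi>' (tor b) = - \<omega> (tor b)"
    using h(2) low by (intro weight_le_antisym[OF _ _ t]) (auto simp: lowest_weight_def)
  ultimately have "complex_of_real s = complex_of_real (2 * r)"
    using s r by simp
  then show "s = 2 * r" by (simp only: of_real_eq_iff)
qed

end

section \<open>The fundamental, standard and adjoint representations\<close>

context adapted
begin

lemma uniton_number_fundamental:
  fixes smul :: "complex \<Rightarrow> 'v::ab_group_add \<Rightarrow> 'v" and \<rho> :: "complex^'d^'d \<Rightarrow> 'v \<Rightarrow> 'v"
  assumes "representation smul V \<rho>" "highest_weight n e smul V \<rho> (fundamental_weight n e k)"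
  shows "uniton_number n e smul V \<rho> (tor b) = (if k < n then 2 * (\<Sum>j=1..k. b j) else (\<Sum>j=1..n. b j))"
proof -
  have L: "(\<Sum>j=1..k. L n e j (tor b)) = \<i> * of_real (\<Sum>j=1..k. b j)" if "k \<le> n" for k
    using that by (simp add: L_tor sum_distrib_left)
  have "fundamental_weight n e k (tor b) =
      \<i> * of_real (if k < n then (\<Sum>j=1..k. b j) else (\<Sum>j=1..n. b j) / 2)"
    using L[of k] L[of n] by (simp add: fundamental_weight_def)
  from uniton_number_eq[OF assms this] show ?thesis by simp
qed

text \<open>
  Abel summation: since \<open>\<alpha>\<^sub>i = L\<^sub>i - L\<^bsub>i+1\<^esub>\<close> for \<open>i < n\<close> and \<open>\<alpha>\<^sub>n = L\<^sub>n\<close>, the coefficients of \<open>\<Sum> y\<^sub>j L\<^sub>j\<close> with respect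
  to the simple roots are the partial sums of \<open>y\<close>.
\<close>

lemma weight_leI:
  fixes y :: "nat \<Rightarrow> int"
  assumes diff: "\<And>b. \<mu> (tor b) - \<nu> (tor b) = (\<Sum>j=1..n. \<i> * of_real (b j) * of_int (y j))"
    and nonneg: "\<And>i. i \<in> {1..n} \<Longrightarrow> 0 \<le> (\<Sum>j=1..i. y j)"
  shows "weight_le n e \<nu> \<mu>"
  unfolding weight_le_def
proof (intro exI ballI)
  fix \<eta> assume "\<eta> \<in> torus n e"
  then obtain b where \<eta>: "\<eta> = tor b" by (auto simp: torus_eq)
  define B where "B j = \<i> * of_real (if j \<le> n then b j else 0)" for j
  have abel: "(\<Sum>i=1..m. of_int (\<Sum>j=1..i. y j) * (B i - B (Suc i))) =
      (\<Sum>i=1..m. B i * of_int (y i)) - of_int (\<Sum>j=1..m. y j) * B (Suc m)" for m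
    by (induction m) (simp_all add: algebra_simps)
  have "(\<Sum>i=1..n. of_nat (nat (\<Sum>j=1..i. y j)) * simple_root n e i \<eta>) =
      (\<Sum>i=1..n. of_int (\<Sum>j=1..i. y j) * (B i - B (Suc i)))"
  proof (intro sum.cong refl)
    fix i assume i: "i \<in> {1..n}"
    have "simple_root n e i \<eta> = B i - B (Suc i)"
      using i by (auto simp: \<eta> simple_root_tor[OF i] B_def algebra_simps)
    moreover have "(of_nat (nat (\<Sum>j=1..i. y j)) :: complex) = of_int (\<Sum>j=1..i. y j)"
      using nonneg[OF i] by (simp only: of_nat_nat)
    ultimately show "of_nat (nat (\<Sum>j=1..i. y j)) * simple_root n e i \<eta> =
        of_int (\<Sum>j=1..i. y j) * (B i - B (Suc i))"
      by (simp only:)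
  qed
  also have "\<dots> = (\<Sum>i=1..n. B i * of_int (y i))"
    unfolding abel by (simp add: B_def)
  also have "\<dots> = \<mu> \<eta> - \<nu> \<eta>"
    unfolding \<eta> diff by (intro sum.cong refl) (simp add: B_def)
  finally show "\<mu> \<eta> - \<nu> \<eta> = (\<Sum>i=1..n. of_nat (nat (\<Sum>j=1..i. y j)) * simple_root n e i \<eta>)" ..
qed

text \<open>
  The coordinates of the weight of \<open>e p\<close>: those of \<open>L\<^sub>p\<close>, of \<open>-L\<^bsub>p-n\<^esub>\<close>, or of \<open>0\<close> for the last basis vector.
\<close>

definition eps :: "nat \<Rightarrow> nat \<Rightarrow> int" where
  "eps p j = (if p \<le> n then (if j = p then 1 else 0) else if j = p - n then (if p = mid then 0 else -1) else 0)"

lemma sum_eps: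
  assumes "p \<in> idx" "i \<le> n"
  shows "(\<Sum>j=1..i. eps p j) = (if p \<le> i then 1 else if n < p \<and> p \<le> n + i then -1 else 0)"
proof -
  consider "p \<le> n" | "n < p" "p \<noteq> mid" | "p = mid" by fastforce
  then show ?thesis
    by cases (use assms in \<open>auto simp: eps_def idx_def mid_def\<close>)
qed

lemma lam_eps:
  assumes "p \<in> idx"
  shows "\<i> * of_real (lam b p) = (\<Sum>j=1..n. \<i> * of_real (b j) * of_int (eps p j))"
proof -
  consider "p \<le> n" | "n < p" "p \<noteq> mid" | "p = mid" by fastforce
  then show ?thesis
  proof cases
    case 1
    have "(\<Sum>j=1..n. \<i> * of_real (b j) * of_int (eps p j)) =
        (\<Sum>j=1..n. if p = j then \<i> * of_real (b j) else 0)"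
      using 1 by (intro sum.cong refl) (auto simp: eps_def)
    then show ?thesis using 1 assms by (simp add: lam_def idx_def)
  next
    case 2
    have "(\<Sum>j=1..n. \<i> * of_real (b j) * of_int (eps p j)) =
        (\<Sum>j=1..n. if p - n = j then - \<i> * of_real (b j) else 0)"
      using 2 by (intro sum.cong refl) (auto simp: eps_def)
    also have "\<dots> = - \<i> * of_real (b (p - n))"
      by (subst sum.delta') (use 2 assms in \<open>auto simp: idx_def mid_def\<close>)
    finally show ?thesis using 2 assms by (simp add: lam_def idx_def mid_def)
  next
    case 3
    then show ?thesis by (simp add: lam_mid eps_def) (simp add: mid_def)
  qed
qed

lemma tor_eigen_opp: "p \<in> idx \<Longrightarrow> tor b *v e (opp p) = (- (\<i> * of_real (lam b p))) *s e (opp p)"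
  by (simp only: tor_eigen[OF opp_in] lam_opp of_real_minus mult_minus_right)

lemma Qform_tor:
  assumes "p \<in> idx"
  shows "Qform (e (opp p)) (tor b *v v) = \<i> * of_real (lam b p) * Qform (e (opp p)) v"
  using soC_skew[OF tor_in_soC, of b "e (opp p)" v]
  unfolding tor_eigen_opp[OF assms] Qform_scale_left by simp

lemma span_basis: "vec.span (e ` idx) = UNIV"
  using adapted_basis by (simp add: adapted_basis_def idx_def)

lemma representation_standard: "representation (*s) UNIV ((*v) :: complex^'d^'d \<Rightarrow> _)"
  unfolding representation_def
  using vec.vector_space_axioms exI[of "\<lambda>B. finite B \<and> vec.span B = UNIV" "e ` idx"] span_basis
  by (auto simp: matrix_vector_right_distrib matrix_vector_mult_add_rdistrib vector_scalar_commute
      mscale_mult_vector bracket_mult_vector)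

text \<open>
  A weight of the standard representation is the weight of some \<open>e p\<close>, namely of any basis vector that
  occurs in the weight vector. Partial sums of such weights are at most \<open>1\<close>, which is the value of all
  partial sums of \<open>L\<^sub>1\<close>.
\<close>

lemma highest_weight_standard: "highest_weight n e (*s) UNIV (*v) (L n e 1)"
  unfolding highest_weight_def
proof (intro conjI allI impI)
  have 1: "1 \<in> {1..n}" "1 \<in> idx" using n_pos by (auto simp: idx_def)
  have L1: "L n e 1 (tor b) = \<i> * of_real (lam b 1)" for b
    using L_tor[OF 1(1)] 1(1) by (simp add: lam_def)
  show "weight n e (*s) UNIV (*v) (L n e 1)"
    unfolding weight_def torus_eq using basis_nonzero[OF 1(2)] tor_eigen[OF 1(2)] L1 by auto
  fix \<nu> assume "weight n e (*s) UNIV (*v) \<nu>"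
  then obtain v where v: "v \<noteq> 0" "\<And>b. tor b *v v = \<nu> (tor b) *s v"
    unfolding weight_def torus_eq by blast
  obtain p where p: "p \<in> idx" "Qform (e (opp p)) v \<noteq> 0"
    using expansion[of v] v(1) by (metis (no_types, lifting) sum.neutral vec.scale_zero_left)
  have \<nu>: "\<nu> (tor b) = \<i> * of_real (lam b p)" for b
    using Qform_tor[OF p(1), of b v] p(2) by (simp add: v(2) Qform_scale_right)
  show "weight_le n e \<nu> (L n e 1)"
  proof (rule weight_leI)
    show "L n e 1 (tor b) - \<nu> (tor b) = (\<Sum>j=1..n. \<i> * of_real (b j) * of_int (eps 1 j - eps p j))" for b
      unfolding L1 \<nu> lam_eps[OF 1(2)] lam_eps[OF p(1)] by (simp add: algebra_simps sum_subtractf)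
    show "0 \<le> (\<Sum>j=1..i. eps 1 j - eps p j)" if "i \<in> {1..n}" for i
      using that sum_eps[OF 1(2), of i] sum_eps[OF p(1), of i] by (simp add: sum_subtractf)
  qed
qed

lemma uniton_number_standard_eq: "uniton_number_standard n e (tor b) = 2 * b 1"
  unfolding uniton_number_standard_def
  by (rule uniton_number_eq[OF representation_standard highest_weight_standard]) (use n_pos in \<open>simp add: L_tor\<close>)

lemma representation_adjoint: "representation mscale (soC :: (complex^'d^'d) set) bracket"
  unfolding representation_def
proof (intro conjI ballI allI)
  show "vector_space (mscale :: complex \<Rightarrow> complex^'d^'d \<Rightarrow> _)"
    by (rule cmat.vector_space_axioms)
  show "cmat.subspace (soC :: (complex^'d^'d) set)"
    by (simp add: soC_span_wedges)
  show "\<exists>B. finite B \<and> cmat.span B = (soC :: (complex^'d^'d) set)"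
    unfolding soC_span_wedges by (intro exI conjI) (auto intro: finite_imageI)
  fix X Y Z :: "complex^'d^'d" and c
  show "X \<in> soC \<Longrightarrow> Y \<in> soC \<Longrightarrow> bracket X Y \<in> soC" by (rule bracket_in_soC)
  have add: "(A + B) ** C = A ** C + B ** C" for A B C :: "complex^'d^'d"
    by (simp add: matrix_matrix_mult_def vec_eq_iff algebra_simps sum.distrib)
  show "bracket X (Y + Z) = bracket X Y + bracket X Z" 
    by (simp add: bracket_def matrix_add_ldistrib add)
  show "bracket (X + Y) Z = bracket X Z + bracket Y Z" 
    by (simp add: bracket_def matrix_add_ldistrib add)
  show "bracket X (mscale c Y) = mscale c (bracket X Y)" by (rule bracket_mscale_right)
  show "bracket (mscale c X) Y = mscale c (bracket X Y)" by (rule bracket_mscale_left)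
  have diff: "(A - B) ** C = A ** C - B ** C" "C ** (A - B) = C ** A - C ** B" for A B C :: "complex^'d^'d"
    by (simp_all add: matrix_matrix_mult_def vec_eq_iff algebra_simps sum_subtractf)
  show "bracket (bracket X Y) Z = bracket X (bracket Y Z) - bracket Y (bracket X Z)"
    by (simp add: bracket_def diff matrix_mul_assoc)
qed

lemma Qform_bracket_tor:
  assumes "p \<in> idx" "q \<in> idx"
  shows "Qform (e (opp p)) (bracket (tor b) X *v e (opp q)) =
    (\<i> * of_real (lam b p) + \<i> * of_real (lam b q)) * Qform (e (opp p)) (X *v e (opp q))"
proof -
  have "Qform (e (opp p)) (bracket (tor b) X *v e (opp q)) =
      Qform (e (opp p)) (tor b *v (X *v e (opp q))) - Qform (e (opp p)) (X *v (tor b *v e (opp q)))"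
    unfolding bracket_mult_vector
    using Qform_add_right[of "e (opp p)" "tor b *v (X *v e (opp q)) - X *v (tor b *v e (opp q))"
       "X *v (tor b *v e (opp q))"] by simp
  also have "\<dots> = (\<i> * of_real (lam b p) + \<i> * of_real (lam b q)) * Qform (e (opp p)) (X *v e (opp q))"
    unfolding Qform_tor[OF assms(1)] tor_eigen_opp[OF assms(2)] vector_scalar_commute Qform_scale_right
    by (simp add: algebra_simps)
  finally show ?thesis .
qed

text \<open>
  Expand \<open>X\<close> into bivectors of basis vectors and take any pair that occurs. Its two members differ because
  the bivector of a vector with itself is zero.
\<close>

lemma weight_adjoint:
  assumes "X \<in> soC" "X \<noteq> 0" "\<And>b. bracket (tor b) X = mscale (c b) X"
  shows "\<exists>p\<in>idx. \<exists>q\<in>idx. p \<noteq> q \<and> (\<forall>b. c b = \<i> * of_real (lam b p) + \<i> * of_real (lam b q))"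
proof -
  obtain p q where pq: "p \<in> idx" "q \<in> idx" "Qform (e (opp p)) (X *v e (opp q)) \<noteq> 0" 
  proof -
    have False if "\<forall>p\<in>idx. \<forall>q\<in>idx. Qform (e (opp p)) (X *v e (opp q)) = 0"
      using soC_expansion[OF assms(1)] that assms(2) by simp
    then show ?thesis using that by blast
  qed
  have "c b = \<i> * of_real (lam b p) + \<i> * of_real (lam b q)" for b
  proof -
    have "c b * Qform (e (opp p)) (X *v e (opp q)) = Qform (e (opp p)) (bracket (tor b) X *v e (opp q))"
      by (simp add: assms(3) mscale_mult_vector Qform_scale_right)
    then show ?thesis using pq(3) by (simp add: Qform_bracket_tor[OF pq(1,2)])
  qed
  moreover have "p \<noteq> q" using pq(3) soC_alternating[OF assms(1)] by auto
  ultimately show ?thesis using pq by blast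
qed

text \<open>
  The basis vector with the second largest weight: \<open>L\<^sub>2\<close> if \<open>n \<ge> 2\<close>, and \<open>0\<close> if \<open>n = 1\<close>.
\<close>

definition second :: nat where
  "second = (if n = 1 then mid else 2)"

text \<open>
  The bivector of the two basis vectors with the largest weights is a highest weight vector. A partial
  sum of another weight is at most \<open>2\<close>, and the first one is at most \<open>1\<close> since \<open>e\<^sub>1\<close> occurs in a bivector only
  once; so no weight exceeds this one.
\<close>

lemma highest_weight_adjoint:
  "highest_weight n e mscale soC bracket (\<lambda>\<eta>. L n e 1 \<eta> + (if n = 1 then 0 else L n e 2 \<eta>))" (is "highest_weight n e mscale soC bracket ?\<omega>")
  unfolding highest_weight_def
proof (intro conjI allI impI)
  have 1: "1 \<in> {1..n}" "1 \<in> idx" "second \<in> idx" "1 \<noteq> second" using n_pos unfolding idx_def second_def mid_def by auto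
  have \<omega>: "?\<omega> (tor b) = \<i> * of_real (lam b 1) + \<i> * of_real (lam b second)" for b
  proof -
    have "lam b 1 = b 1" using 1(1) by (simp add: lam_def)
    moreover have "lam b second = (if n = 1 then 0 else b 2)"
    proof (cases "n = 1")
      case True
      then have "second = mid" by (rule second_def[THEN trans, OF if_P])
      with True show ?thesis using lam_mid by presburger
    next
      case False
      then show ?thesis using n_pos by (simp add: second_def lam_def)
    qed
    ultimately show ?thesis
      using L_tor[OF 1(1), of b] L_tor[of 2 b] n_pos by (auto split: if_splits)
  qed
  have "bracket (tor b) (wedge (e 1) (e second)) = mscale (?\<omega> (tor b)) (wedge (e 1) (e second))" for b
    unfolding bracket_wedge[OF tor_in_soC] \<omega> tor_eigen[OF 1(2)] tor_eigen[OF 1(3)]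
      wedge_scale_left wedge_scale_right by (simp add: cmat.scale_left_distrib)
  moreover have "wedge (e 1) (e second) \<noteq> 0"
  proof -
    have "opp second \<noteq> opp 1" using 1 opp_opp by metis
    then have "wedge (e 1) (e second) *v e (opp second) = e 1"
      using 1 by (simp add: wedge_mult_vector Qform_basis opp_in)
    then show ?thesis using basis_nonzero[OF 1(2)] by auto
  qed
  ultimately show "weight n e mscale soC bracket ?\<omega>"
    unfolding weight_def torus_eq by (auto intro!: bexI[of _ "wedge (e 1) (e second)"])
  fix \<nu> assume "weight n e mscale (soC :: (complex^'d^'d) set) bracket \<nu>"
  then obtain X :: "complex^'d^'d" where X: "X \<in> soC" "X \<noteq> 0" "\<And>b. bracket (tor b) X = mscale (\<nu> (tor b)) X"
    unfolding weight_def torus_eq by blast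
  obtain p q where p: "p \<in> idx" and q: "q \<in> idx" and ne: "p \<noteq> q"
     and \<nu>: "\<And>b. \<nu> (tor b) = \<i> * of_real (lam b p) + \<i> * of_real (lam b q)"
    using weight_adjoint[OF X] by blast
  show "weight_le n e \<nu> ?\<omega>"
  proof (rule weight_leI)
    show "?\<omega> (tor b) - \<nu> (tor b) =
        (\<Sum>j=1..n. \<i> * of_real (b j) * of_int (eps 1 j + eps second j - (eps p j + eps q j)))" for b
      unfolding \<omega> \<nu> lam_eps[OF 1(2)] lam_eps[OF 1(3)] lam_eps[OF p] lam_eps[OF q]
      by (simp add: algebra_simps sum_subtractf sum.distrib)
    show "0 \<le> (\<Sum>j=1..i. eps 1 j + eps second j - (eps p j + eps q j))" if i: "i \<in> {1..n}" for i
    proof -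
      have "1 \<le> i" "i \<le> n" "1 \<le> p" "1 \<le> q" "p \<le> mid" "q \<le> mid" "1 \<le> n" "mid = 2 * n + 1" 
        using i p q by (auto simp: idx_def mid_def)
      then show ?thesis
        unfolding sum_subtractf sum.distrib sum_eps[OF 1(2) \<open>i \<le> n\<close>] sum_eps[OF 1(3) \<open>i \<le> n\<close>]
          sum_eps[OF p \<open>i \<le> n\<close>] sum_eps[OF q \<open>i \<le> n\<close>]
        using ne by (auto simp: second_def)
    qed
  qed
qed

lemma uniton_number_adjoint_eq:
  "uniton_number_adjoint n e (tor b) = 2 * (b 1 + (if n = 1 then 0 else b 2))"
  unfolding uniton_number_adjoint_def
  by (rule uniton_number_eq[OF representation_adjoint highest_weight_adjoint])
     (use n_pos in \<open>simp add: L_tor algebra_simps\<close>)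

end

section \<open>The exponential map and the lattices\<close>

lemma mexp_summable:
  fixes A :: "complex^'d^'d"
  shows "summable (\<lambda>k. (1 / fact k) *\<^sub>R (((**) A) ^^ k) (mat 1))"
proof -
  have "linear (\<lambda>X :: complex^'d^'d. A ** X)"
    by (rule linearI) (simp_all add: matrix_add_ldistrib scaleR_eq_mscale matrix_mult_mscale)
  then interpret bounded_linear "\<lambda>X :: complex^'d^'d. A ** X" by (simp add: linear_conv_bounded_linear)
  obtain K where K: "0 < K" "\<And>X :: complex^'d^'d. norm (A ** X) \<le> norm X * K" using pos_bounded by blast
  have bound: "norm ((((**) A) ^^ k) (mat 1)) \<le> norm (mat 1 :: complex^'d^'d) * K ^ k" for k
  proof (induction k)
    case (Suc k)
    have "norm ((((**) A) ^^ Suc k) (mat 1)) \<le> norm ((((**) A) ^^ k) (mat 1)) * K"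
      using K(2) by simp
    also have "\<dots> \<le> norm (mat 1 :: complex^'d^'d) * K ^ k * K"
      using Suc K(1) by (simp add: mult_right_mono)
    finally show ?case by (simp add: mult_ac)
  qed simp
  have "summable (\<lambda>k. norm (mat 1 :: complex^'d^'d) * (inverse (fact k) * K ^ k))"
    by (intro summable_mult summable_exp)
  then show ?thesis
  proof (rule summable_comparison_test')
    fix k :: nat assume "0 \<le> k"
    show "norm ((1 / fact k) *\<^sub>R (((**) A) ^^ k) (mat 1)) \<le> norm (mat 1 :: complex^'d^'d) * (inverse (fact k) * K ^ k)"
      using mult_left_mono[OF bound[of k], of "1 / fact k"] by (simp add: field_simps)
  qed
qed

lemma of_real_smult: "of_real r *s v = r *\<^sub>R (v :: complex^'d)"
  by (simp add: vec_eq_iff) (simp add: scaleR_conv_of_real)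

text \<open>
  Evaluation at \<open>v\<close> is continuous, so the power series may be summed on the eigenvector.
\<close>

lemma mexp_eigenvector:
  fixes A :: "complex^'d^'d"
  assumes "A *v v = c *s v"
  shows "mexp A *v v = exp c *s v"
proof -
  have "linear (\<lambda>M :: complex^'d^'d. M *v v)"
    by (rule linearI)
       (simp_all add: matrix_vector_mult_add_rdistrib scaleR_eq_mscale mscale_mult_vector of_real_smult)
  then interpret ev: bounded_linear "\<lambda>M :: complex^'d^'d. M *v v" by (simp add: linear_conv_bounded_linear)
  have "linear (\<lambda>x :: complex. x *s v)"
    by (rule linearI) (simp_all add: vec.scale_left_distrib vec_eq_iff)
  then interpret sc: bounded_linear "\<lambda>x :: complex. x *s v" by (simp add: linear_conv_bounded_linear)
  have pow: "(((**) A) ^^ k) (mat 1) *v v = c ^ k *s v" for k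
  proof (induction k)
    case (Suc k)
    have "(((**) A) ^^ Suc k) (mat 1) *v v = A *v ((((**) A) ^^ k) (mat 1) *v v)"
      by (simp add: matrix_vector_mul_assoc)
    then show ?case by (simp add: Suc vector_scalar_commute assms mult.commute)
  qed simp
  have "mexp A *v v = (\<Sum>k. ((1 / fact k) *\<^sub>R (((**) A) ^^ k) (mat 1)) *v v)"
    unfolding mexp_def by (rule ev.suminf[OF mexp_summable])
  also have "\<dots> = (\<Sum>k. (c ^ k /\<^sub>R fact k) *s v)"
    by (simp only: ev.scaleR sc.scaleR pow inverse_eq_divide)
  also have "\<dots> = exp c *s v"
    unfolding exp_def by (rule sc.suminf[symmetric, OF summable_exp_generic])
  finally show ?thesis .
qed

context adapted
begin

lemma mexp_tor: "p \<in> idx \<Longrightarrow> mexp (t *\<^sub>R tor a) *v e p = exp (\<i> * of_real (t * lam a p)) *s e p"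
  by (rule mexp_eigenvector) (simp add: scaleR_eq_mscale mscale_mult_vector tor_eigen mult.left_commute)

lemma mexp_tor_eq_1:
  "mexp (t *\<^sub>R tor a) = mat 1 \<longleftrightarrow> (\<forall>j\<in>{1..n}. \<exists>k::int. t * a j = 2 * pi * of_int k)"
proof
  assume eq: "mexp (t *\<^sub>R tor a) = mat 1"
  show "\<forall>j\<in>{1..n}. \<exists>k::int. t * a j = 2 * pi * of_int k"
  proof
    fix j assume j: "j \<in> {1..n}"
    then have jI: "j \<in> idx" "lam a j = a j" by (auto simp: idx_def lam_def)
    have "exp (\<i> * of_real (t * a j)) *s e j = 1 *s e j"
      using mexp_tor[OF jI(1), of t a] eq jI(2) by simp
    then have "exp (\<i> * of_real (t * a j)) = 1"
      using basis_nonzero[OF jI(1)] by (simp only: vec.scale_right_imp_eq vec.scale_cancel_right) simp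
    then show "\<exists>k::int. t * a j = 2 * pi * of_int k"
      by (auto simp: exp_eq_1 mult_ac)
  qed
next
  assume *: "\<forall>j\<in>{1..n}. \<exists>k::int. t * a j = 2 * pi * of_int k"
  show "mexp (t *\<^sub>R tor a) = mat 1"
  proof (rule matrix_eq_on_basis)
    fix p assume p: "p \<in> idx"
    have "\<exists>k::int. t * lam a p = 2 * pi * of_int k"
      using p
    proof (cases rule: idx_cases)
      case 1 then show ?thesis using * by (simp add: lam_def)
    next
      case 2
      then obtain k :: int where "t * a (p - n) = 2 * pi * of_int k" using * by blast
      then have "t * lam a p = 2 * pi * of_int (- k)" using 2 by (simp add: lam_def)
      then show ?thesis ..
    next
      case 3 then show ?thesis by (intro exI[of _ 0]) (simp add: lam_mid)
    qed
    then have "exp (\<i> * of_real (t * lam a p)) = 1"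
      by (auto simp: exp_eq_1)
    then show "mexp (t *\<^sub>R tor a) *v e p = mat 1 *v e p"
      using mexp_tor[OF p, of t a] by simp
  qed
qed

lemma integer_lattice_tor: "tor a \<in> integer_lattice n e \<longleftrightarrow> (\<forall>j\<in>{1..n}. a j \<in> \<int>)"
proof -
  have "(\<exists>k::int. 2 * pi * a j = 2 * pi * of_int k) \<longleftrightarrow> a j \<in> \<int>" for j
    by (auto simp: Ints_def)
  then show ?thesis by (simp add: integer_lattice_def torus_eq mexp_tor_eq_1)
qed

lemma half_lattice_tor: "tor a \<in> half_lattice n e \<longleftrightarrow> (\<forall>j\<in>{1..n}. \<exists>k::int. a j = 2 * of_int k)"
proof -
  have "(\<exists>k::int. pi * a j = 2 * pi * of_int k) \<longleftrightarrow> (\<exists>k::int. a j = 2 * of_int k)" for j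
    by (simp add: mult.left_commute[of 2 pi])
  then show ?thesis by (simp add: half_lattice_def torus_eq mexp_tor_eq_1)
qed

lemma imaginary_nonneg: "\<i> * of_real r / \<i> \<in> \<real>\<^sub>\<ge>\<^sub>0 \<longleftrightarrow> 0 \<le> r"
  by simp

lemma dominant_lattice_tor:
  "tor a \<in> dominant_lattice n e \<longleftrightarrow> (\<forall>j\<in>{1..n}. a j \<in> \<int> \<and> 0 \<le> a j) \<and>
     (\<forall>i\<in>{1..n}. \<forall>j\<in>{1..n}. i < j \<longrightarrow> a j \<le> a i)"
proof -
  have pos: "\<alpha> \<in> positive_roots n e \<longleftrightarrow>
     (\<exists>i j. 1 \<le> i \<and> i < j \<and> j \<le> n \<and> \<alpha> = (\<lambda>\<eta>. L n e i \<eta> + L n e j \<eta>)) \<or>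
     (\<exists>i j. 1 \<le> i \<and> i < j \<and> j \<le> n \<and> \<alpha> = (\<lambda>\<eta>. L n e i \<eta> - L n e j \<eta>)) \<or>
     (\<exists>i. 1 \<le> i \<and> i \<le> n \<and> \<alpha> = L n e i)" for \<alpha>
    unfolding positive_roots_def by blast
  have "(\<forall>\<alpha>\<in>positive_roots n e. \<alpha> (tor a) / \<i> \<in> \<real>\<^sub>\<ge>\<^sub>0) \<longleftrightarrow>
     (\<forall>i j. 1 \<le> i \<and> i < j \<and> j \<le> n \<longrightarrow> 0 \<le> a i + a j) \<and>
     (\<forall>i j. 1 \<le> i \<and> i < j \<and> j \<le> n \<longrightarrow> 0 \<le> a i - a j) \<and>
     (\<forall>i. 1 \<le> i \<and> i \<le> n \<longrightarrow> 0 \<le> a i)" (is "?l \<longleftrightarrow> ?r")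
  proof -
    have 1: "(L n e i (tor a) + L n e j (tor a)) / \<i> \<in> \<real>\<^sub>\<ge>\<^sub>0 \<longleftrightarrow> 0 \<le> a i + a j"
      "(L n e i (tor a) - L n e j (tor a)) / \<i> \<in> \<real>\<^sub>\<ge>\<^sub>0 \<longleftrightarrow> 0 \<le> a i - a j"
      if "1 \<le> i \<and> i < j \<and> j \<le> n" for i j
    proof -
      have "L n e i (tor a) = \<i> * of_real (a i)" "L n e j (tor a) = \<i> * of_real (a j)"
        using that by (simp_all add: L_tor)
      then have "L n e i (tor a) + L n e j (tor a) = \<i> * of_real (a i + a j)"
        "L n e i (tor a) - L n e j (tor a) = \<i> * of_real (a i - a j)"
        by (simp_all add: algebra_simps)
      then show "(L n e i (tor a) + L n e j (tor a)) / \<i> \<in> \<real>\<^sub>\<ge>\<^sub>0 \<longleftrightarrow> 0 \<le> a i + a j"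
        "(L n e i (tor a) - L n e j (tor a)) / \<i> \<in> \<real>\<^sub>\<ge>\<^sub>0 \<longleftrightarrow> 0 \<le> a i - a j"
        by (simp_all only: imaginary_nonneg)
    qed
    have 2: "L n e i (tor a) / \<i> \<in> \<real>\<^sub>\<ge>\<^sub>0 \<longleftrightarrow> 0 \<le> a i" if "1 \<le> i \<and> i \<le> n" for i
      using that imaginary_nonneg[of "a i"] by (simp add: L_tor)
    show ?thesis
      unfolding Ball_def pos using 1 2 by blast
  qed
  then show ?thesis
    unfolding dominant_lattice_def mem_Collect_eq integer_lattice_tor
    by (force intro: add_nonneg_nonneg)
qed

section \<open>Canonical elements have jumps at most one\<close>

text \<open>
  The eigenvalues of the adjoint action of \<open>tor a\<close> are \<open>\<i>\<close> times the sums \<open>lam a p + lam a q\<close>, with bivectors of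
  basis vectors as common eigenvectors for all of the torus. So an inclusion of parabolics is a comparison
  of thresholds for these sums.
\<close>

lemma prec_torI:
  assumes int: "\<And>p. p \<in> idx \<Longrightarrow> lam a' p \<in> \<int>"
    and mono: "\<And>p q i. p \<in> idx \<Longrightarrow> q \<in> idx \<Longrightarrow> 0 \<le> i \<Longrightarrow> lam a p + lam a q \<le> i \<Longrightarrow> lam a' p + lam a' q \<le> i"
  shows "prec (tor a) (tor a')"
  unfolding prec_def
proof (intro allI impI)
  fix i :: int assume i: "0 \<le> i"
  show "parabolic (tor a) i \<subseteq> parabolic (tor a') i"
    unfolding parabolic_def
  proof (rule cmat.span_minimal[OF _ cmat.subspace_span], rule subsetI)
    fix X assume "X \<in> (\<Union>j\<in>{..i}. ad_eigenspace (tor a) j)"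
    then obtain j where j: "j \<le> i" and X: "X \<in> soC" "bracket (tor a) X = mscale (\<i> * of_int j) X"
      by (auto simp: ad_eigenspace_def)
    let ?U = "\<Union>j\<in>{..i}. ad_eigenspace (tor a') j"
    let ?c = "\<lambda>p q. Qform (e (opp p)) (X *v e (opp q))"
    have "mscale (?c p q / 2) (wedge (e p) (e q)) \<in> cmat.span ?U" if p: "p \<in> idx" and q: "q \<in> idx" for p q
    proof (cases "?c p q = 0")
      case True
      then show ?thesis by (simp add: cmat.span_zero)
    next
      case False
      have "\<i> * of_int j * ?c p q = (\<i> * of_real (lam a p) + \<i> * of_real (lam a q)) * ?c p q"
        using Qform_bracket_tor[OF p q, of a X] by (simp add: X(2) mscale_mult_vector Qform_scale_right)
      then have "\<i> * of_int j = \<i> * of_real (lam a p) + \<i> * of_real (lam a q)"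
        using False by simp
      then have "of_real (of_int j) = (of_real (lam a p + lam a q) :: complex)"
        by (simp flip: distrib_left)
      then have "lam a p + lam a q = of_int j" by (simp only: of_real_eq_iff)
      then have le: "lam a' p + lam a' q \<le> of_int i" using mono[OF p q, of "of_int i"] i j by simp
      obtain l :: int where l: "lam a' p + lam a' q = of_int l"
        using Ints_add[OF int[OF p] int[OF q]] by (auto elim: Ints_cases)
      have "bracket (tor a') (wedge (e p) (e q)) = mscale (\<i> * of_real (lam a' p) + \<i> * of_real (lam a' q)) (wedge (e p) (e q))"
        unfolding bracket_wedge[OF tor_in_soC] tor_eigen[OF p] tor_eigen[OF q] wedge_scale_left wedge_scale_right
        by (simp add: cmat.scale_left_distrib)
      also have "\<i> * of_real (lam a' p) + \<i> * of_real (lam a' q) = \<i> * of_int l"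
      proof -
        have "\<i> * of_real (lam a' p) + \<i> * of_real (lam a' q) = \<i> * of_real (lam a' p + lam a' q)"
          by (simp add: distrib_left)
        then show ?thesis by (simp add: l)
      qed
      finally have "wedge (e p) (e q) \<in> ad_eigenspace (tor a') l" by (simp add: ad_eigenspace_def)
      moreover have "l \<le> i" using le l by simp
      ultimately show ?thesis by (intro cmat.span_scale cmat.span_base) auto
    qed
    then show "X \<in> cmat.span ?U"
      by (subst soC_expansion[OF X(1)]) (intro cmat.span_sum)
  qed
qed

text \<open>
  Otherwise subtract \<open>2 H\<^sub>k\<close>. This moves the eigenvalues \<open>lam\<close> with absolute value at least \<open>a\<^sub>k\<close> by \<open>2\<close> towards
  zero and fixes the others, which have absolute value at most \<open>a\<^sub>k - 2\<close>; it is therefore an odd,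
  monotone operation on the eigenvalues which does not increase differences. Hence every sum of two
  eigenvalues that is at most some \<open>i \<ge> 0\<close> remains so.
\<close>

lemma canonical_jump:
  assumes can: "symmetric_canonical n e (tor a)" and k: "k \<in> {1..n}"
  shows "a k - (if k < n then a (k + 1) else 0) < 2"
proof (rule ccontr)
  assume neg: "\<not> ?thesis"
  define a' where "a' j = (if j \<le> k then a j - 2 else a j)" for j
  have dom: "\<And>j. j \<in> {1..n} \<Longrightarrow> a j \<in> \<int> \<and> 0 \<le> a j" "\<And>i j. i \<in> {1..n} \<Longrightarrow> j \<in> {1..n} \<Longrightarrow> i < j \<Longrightarrow> a j \<le> a i"
    using can unfolding symmetric_canonical_def dominant_lattice_tor by auto
  have hi: "a k \<le> a j" if "j \<in> {1..k}" for j
    using that k dom(2)[of j k] by (cases "j = k") auto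
  have lo: "a j \<le> a k - 2" if "j \<in> {k<..n}" for j
  proof -
    have "a j \<le> a (k + 1)" using that k dom(2)[of "k + 1" j] by (cases "j = k + 1") auto
    then show ?thesis using neg that by (auto split: if_splits)
  qed
  have T: "2 \<le> a k"
  proof (cases "k < n")
    case True
    then show ?thesis using neg dom(1)[of "k + 1"] by auto
  qed (use neg in auto)
  have a'_dom: "tor a' \<in> dominant_lattice n e"
    unfolding dominant_lattice_tor
  proof (intro conjI ballI impI)
    fix j assume j: "j \<in> {1..n}"
    show "a' j \<in> \<int>" using dom(1)[OF j] by (simp add: a'_def)
    show "0 \<le> a' j" using dom(1)[OF j] hi[of j] T j by (auto simp: a'_def)
    fix i assume i: "i \<in> {1..n}" and "j < i"
    then show "a' i \<le> a' j"
      using dom(2)[OF j i] hi[of j] lo[of i] i j by (auto simp: a'_def)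
  qed
  have cases: "(a k \<le> lam a p \<and> lam a' p = lam a p - 2) \<or> (lam a p \<le> - a k \<and> lam a' p = lam a p + 2) \<or>
      (\<bar>lam a p\<bar> \<le> a k - 2 \<and> lam a' p = lam a p)" if "p \<in> idx" for p
  proof -
    have "(a k \<le> a j \<and> a' j = a j - 2) \<or> (\<bar>a j\<bar> \<le> a k - 2 \<and> a' j = a j)" if "j \<in> {1..n}" for j
      using hi[of j] lo[of j] dom(1)[OF that] that by (auto simp: a'_def)
    note * = this
    from \<open>p \<in> idx\<close> show ?thesis
    proof (cases rule: idx_cases)
      case 1
      then show ?thesis using *[of p] by (auto simp: lam_def)
    next
      case 2
      then have "lam a p = - a (p - n)" "lam a' p = - a' (p - n)" by (simp_all add: lam_def)
      then show ?thesis using *[OF 2(1)] by auto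
    next
      case 3
      then show ?thesis using T by (simp add: lam_mid)
    qed
  qed
  have "prec (tor a) (tor a')"
  proof (rule prec_torI)
    have int: "a' j \<in> \<int>" if "j \<in> {1..n}" for j
      using a'_dom that unfolding dominant_lattice_tor by blast
    show "lam a' p \<in> \<int>" if "p \<in> idx" for p
      using that
    proof (cases rule: idx_cases)
      case 1 then show ?thesis using int by (simp add: lam_def)
    next
      case 2 then show ?thesis using int[of "p - n"] by (simp add: lam_def)
    next
      case 3 then show ?thesis by (simp add: lam_mid)
    qed
    show "lam a' p + lam a' q \<le> i"
      if "p \<in> idx" "q \<in> idx" "0 \<le> i" "lam a p + lam a q \<le> i" for p q i
      using cases[OF that(1)] cases[OF that(2)] that(3,4) T by linarith
  qed
  moreover have "tor a - tor a' \<in> half_lattice n e"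
    unfolding tor_diff half_lattice_tor
  proof
    fix j assume "j \<in> {1..n}"
    show "\<exists>l::int. a j - a' j = 2 * of_int l"
      by (rule exI[of _ "if j \<le> k then 1 else 0"]) (simp add: a'_def)
  qed
  ultimately have "tor a' = tor a"
    using can a'_dom unfolding symmetric_canonical_def prec_I_def by blast
  from tor_inj[OF this k] show False by (simp add: a'_def)
qed

end

section \<open>The real Grassmannian\<close>

lemma Re_herm: "Re (herm u v) = u \<bullet> v"
  by (simp add: herm_def inner_vec_def inner_complex_def)

lemma herm_diff_left: "herm (u - u') v = herm u v - herm u' v"
  by (simp add: herm_def algebra_simps sum_subtractf)

lemma herm_add_left: "herm (u + u') v = herm u v + herm u' v"
  by (simp add: herm_def algebra_simps sum.distrib)

lemma herm_scale_left: "herm (c *s u) v = c * herm u v"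
  by (simp add: herm_def sum_distrib_left mult.assoc)

lemma herm_scale_right: "herm u (c *s v) = cnj c * herm u v"
  by (simp add: herm_def sum_distrib_left mult_ac)

lemma herm_self_eq_0: "herm v v = 0 \<Longrightarrow> v = 0"
  using Re_herm[of v v] by simp

text \<open>
  The real part of \<open>herm\<close> is the Euclidean inner product, and a subspace closed under multiplication by \<open>\<i>\<close> is
  orthogonal to a vector for the one form as soon as it is for the other. So the real orthogonal
  decomposition yields the projection, whose uniqueness makes it complex linear.
\<close>

lemma orth_proj:
  assumes V: "vec.subspace (V :: (complex^'d) set)"
  shows "orth_proj V *v v \<in> V" and "w \<in> V \<Longrightarrow> herm (v - orth_proj V *v v) w = 0"
proof -
  have real: "subspace V"
    using V unfolding vec.subspace_def subspace_def by (metis of_real_smult)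
  have "\<exists>y. y \<in> V \<and> (\<forall>w\<in>V. herm (v - y) w = 0)" for v
  proof -
    obtain y z where yz: "y \<in> span V" "\<And>w. w \<in> span V \<Longrightarrow> orthogonal z w" "v = y + z"
      using orthogonal_subspace_decomp_exists[of V v] by metis
    have sp: "span V = V" using real by (simp add: span_eq_iff)
    have "herm (v - y) w = 0" if w: "w \<in> V" for w
    proof (rule complex_eqI)
      show "Re (herm (v - y) w) = Re 0"
        using yz(2)[of w] w sp by (simp add: Re_herm yz(3) orthogonal_def)
      have "\<i> *s w \<in> V" using V w by (simp add: vec.subspace_def)
      then have "Re (herm (v - y) (\<i> *s w)) = 0"
        using yz(2)[of "\<i> *s w"] sp by (simp add: Re_herm yz(3) orthogonal_def)
      then show "Im (herm (v - y) w) = Im 0" by (simp add: herm_scale_right)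
    qed
    then show ?thesis using yz(1) sp by auto
  qed
  then obtain f where f: "\<And>v. f v \<in> V" "\<And>v w. w \<in> V \<Longrightarrow> herm (v - f v) w = 0"
    by metis
  have uniq: "y = f v" if "y \<in> V" "\<And>w. w \<in> V \<Longrightarrow> herm (v - y) w = 0" for y v
  proof -
    have "y - f v \<in> V" using that(1) f(1) by (rule vec.subspace_diff[OF V])
    then have "herm (v - f v) (y - f v) - herm (v - y) (y - f v) = 0" using that(2) f(2) by simp
    then have "herm (y - f v) (y - f v) = 0" by (simp flip: herm_diff_left)
    then show ?thesis using herm_self_eq_0[of "y - f v"] by simp
  qed
  have lin: "Vector_Spaces.linear (*s) (*s) f"
    unfolding Vector_Spaces.linear_iff
  proof (intro conjI allI vec.vector_space_axioms)
    show "f (u + v) = f u + f v" for u v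
    proof (rule uniq[symmetric])
      show "f u + f v \<in> V" using f(1) V by (simp add: vec.subspace_add)
      show "herm (u + v - (f u + f v)) w = 0" if "w \<in> V" for w
        using f(2)[OF that, of u] f(2)[OF that, of v] by (simp add: herm_diff_left herm_add_left)
    qed
    show "f (c *s u) = c *s f u" for c u
    proof (rule uniq[symmetric])
      show "c *s f u \<in> V" using f(1) V by (simp add: vec.subspace_scale)
      show "herm (c *s u - c *s f u) w = 0" if "w \<in> V" for w
        using f(2)[OF that, of u] by (simp add: herm_diff_left herm_scale_left)
    qed
  qed
  have "orth_proj V = matrix f"
    unfolding orth_proj_def
  proof (rule the_equality)
    show "\<forall>v. matrix f *v v \<in> V \<and> (\<forall>w\<in>V. herm (v - matrix f *v v) w = 0)"
      using f by (simp add: matrix_works[OF lin])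
    fix P assume "\<forall>v. P *v v \<in> V \<and> (\<forall>w\<in>V. herm (v - P *v v) w = 0)"
    then have "P *v v = matrix f *v v" for v
      using uniq[of "P *v v" v] by (simp add: matrix_works[OF lin])
    then show "P = matrix f" by (simp add: matrix_eq)
  qed
  then show "orth_proj V *v v \<in> V" and "w \<in> V \<Longrightarrow> herm (v - orth_proj V *v v) w = 0"
    using f by (simp_all add: matrix_works[OF lin])
qed

lemma orth_proj_fixed:
  assumes V: "vec.subspace V"
  shows "orth_proj V *v v = v \<longleftrightarrow> v \<in> V"
proof
  show "v \<in> V" if "orth_proj V *v v = v" using orth_proj(1)[OF V, of v] that by simp
  assume v: "v \<in> V"
  have "v - orth_proj V *v v \<in> V" by (rule vec.subspace_diff[OF V v orth_proj(1)[OF V]])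
  from herm_self_eq_0[OF orth_proj(2)[OF V this]] show "orth_proj V *v v = v" by simp
qed

text \<open>
  The sign in \<open>iota m\<close> depends on the parity of \<open>m\<close>, and so does the eigenvalue to which \<open>V\<close> belongs.
\<close>

lemma iota_eigenspace:
  assumes V: "vec.subspace V"
  shows "{v. iota m V *v v = (if even m then - 1 else 1) *s v} = V"
proof -
  have "iota m V *v v = (if even m then - 1 else 1) *s v \<longleftrightarrow> orth_proj V *v v = v" for v
  proof -
    have "iota m V *v v = (if even m then v - orth_proj V *v v - orth_proj V *v v
        else orth_proj V *v v - (v - orth_proj V *v v))"
      by (cases "even m")
        (simp_all only: iota_def if_True if_False matrix_vector_mult_diff_rdistrib matrix_vector_mul_lid)
    moreover have "v - P - P = - v \<longleftrightarrow> P = v" "P - (v - P) = v \<longleftrightarrow> P = v" for P :: "complex^'a"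
    proof -
      have "v - P - P = - v \<longleftrightarrow> 2 *\<^sub>R (v - P) = 0" "P - (v - P) = v \<longleftrightarrow> 2 *\<^sub>R (v - P) = 0"
        by (auto simp: scaleR_2 algebra_simps)
      then show "v - P - P = - v \<longleftrightarrow> P = v" "P - (v - P) = v \<longleftrightarrow> P = v" by auto
    qed
    ultimately show ?thesis by simp
  qed
  then show ?thesis using orth_proj_fixed[OF V] by auto
qed

context adapted
begin

lemma dim_eigenspace:
  assumes "\<And>p. p \<in> idx \<Longrightarrow> g *v e p = c p *s e p"
  shows "vec.dim {v. g *v v = d *s v} = card {p \<in> idx. c p = d}"
proof -
  let ?P = "{p \<in> idx. c p = d}"
  have inj: "inj_on e idx" and ind: "vec.independent (e ` idx)"
    using adapted_basis by (auto simp: adapted_basis_def idx_def)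
  have "{v. g *v v = d *s v} = vec.span (e ` ?P)"
  proof
    show "vec.span (e ` ?P) \<subseteq> {v. g *v v = d *s v}"
    proof (rule vec.span_minimal)
      show "e ` ?P \<subseteq> {v. g *v v = d *s v}" using assms by auto
      show "vec.subspace {v. g *v v = d *s v}"
        by (auto simp: vec.subspace_def matrix_vector_right_distrib vector_scalar_commute mult.commute)
    qed
    show "{v. g *v v = d *s v} \<subseteq> vec.span (e ` ?P)"
    proof
      fix v assume "v \<in> {v. g *v v = d *s v}"
      then have v: "g *v v = d *s v" by simp
      have "Qform (e (opp p)) v *s e p \<in> vec.span (e ` ?P)" if p: "p \<in> idx" for p
      proof (cases "c p = d")
        case True
        then show ?thesis using p by (intro vec.span_scale vec.span_base) auto
      next
        case False
        have "g *v v = (\<Sum>q\<in>idx. (Qform (e (opp q)) v * c q) *s e q)"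
          by (subst expansion[of v]) (simp add: mult_vector_sum vector_scalar_commute assms)
        then have "Qform (e (opp p)) (g *v v) = (\<Sum>q\<in>idx. if q = p then Qform (e (opp q)) v * c q else 0)"
          by (simp only: Qform_sum_right Qform_scale_right) (intro sum.cong refl, simp add: Qform_opp[OF p])
        then have "d * Qform (e (opp p)) v = Qform (e (opp p)) v * c p"
          using p by (simp add: v Qform_scale_right)
        then have "Qform (e (opp p)) v = 0" using False by simp
        then show ?thesis by (simp add: vec.span_zero)
      qed
      then show "v \<in> vec.span (e ` ?P)"
        by (subst expansion[of v]) (intro vec.span_sum)
    qed
  qed
  moreover have "vec.independent (e ` ?P)"
    by (rule vec.independent_mono[OF ind]) auto
  ultimately show ?thesis
    using card_image[OF inj_on_subset[OF inj], of ?P] by (simp add: vec.dim_eq_card_independent)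
qed

end

lemma gamma_in_N_class:
  fixes \<xi> :: "complex^'d^'d"
  shows "gamma \<xi> (- 1) \<in> N_class \<xi>"
proof -
  have "mat 1 \<in> (SO :: (complex^'d^'d) set)"
  proof -
    have "map_matrix complex_of_real (mat 1 :: real^'d^'d) = mat 1"
      by (simp add: map_matrix_def mat_def vec_eq_iff)
    moreover have "rotation_matrix (mat 1 :: real^'d^'d)"
      by (simp add: rotation_matrix_def orthogonal_matrix_id)
    ultimately show ?thesis unfolding SO_def by (metis imageI mem_Collect_eq)
  qed
  moreover have "matrix_inv (mat 1) = (mat 1 :: complex^'d^'d)"
    unfolding matrix_inv_def by (rule some_equality) auto
  ultimately show ?thesis
    unfolding N_class_def by (auto intro!: exI[of _ "mat 1"])
qed

lemma gamma_minus_1: "gamma \<xi> (- 1) = mexp (pi *\<^sub>R \<xi>)"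
proof -
  have "- \<i> * Ln (- 1) = of_real pi" by simp
  then show ?thesis unfolding gamma_def scaleR_eq_mscale by (simp only:)
qed

lemma exp_ipi_int: "exp (\<i> * of_real (pi * of_int k)) = (if even k then 1 else - 1)"
proof -
  have even: "exp (\<i> * of_real (pi * of_int (2 * l))) = 1" for l
    unfolding exp_eq_1 by (auto intro!: exI[of _ l])
  show ?thesis
  proof (cases "even k")
    case True
    then obtain l where "k = 2 * l" by blast
    then show ?thesis using even by simp
  next
    case False
    then obtain l where l: "k = 2 * l + 1" by (rule oddE)
    have "\<i> * of_real (pi * of_int k) = \<i> * of_real (pi * of_int (2 * l)) + \<i> * of_real pi"
      by (simp add: l algebra_simps)
    then have "exp (\<i> * of_real (pi * of_int k)) = exp (\<i> * of_real pi)"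
      by (simp only: exp_add even mult_1_left)
    then show ?thesis using False by simp
  qed
qed

section \<open>Counting parities\<close>

text \<open>
  A sequence that ends at most at \<open>1\<close> and drops by at most one in each step skips no positive integer
  below its first value.
\<close>

lemma descending_values:
  fixes z :: "nat \<Rightarrow> int"
  assumes step: "\<And>j. 1 \<le> j \<Longrightarrow> j < n \<Longrightarrow> z j \<le> z (Suc j) + 1" and last: "z n \<le> 1"
    and i: "1 \<le> i" "i \<le> n"
  shows "{1..z i} \<subseteq> z ` {i..n}" and "z i \<le> int (n - i) + 1"
proof -
  have "{1..z i} \<subseteq> z ` {i..n} \<and> z i \<le> int (n - i) + 1"
    using i(2) i(1)
  proof (induction i rule: inc_induct)
    case base
    have "{1..z n} \<subseteq> {z n}" using last by auto
    then show ?case using last by simp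
  next
    case (step i)
    have "{1..z i} \<subseteq> insert (z i) {1..z (Suc i)}"
      using assms(1)[of i] step by auto
    also have "\<dots> \<subseteq> insert (z i) (z ` {Suc i..n})" using step by auto
    also have "\<dots> = z ` {i..n}" using step by (simp add: atLeastAtMost_insertL flip: image_insert)
    finally show ?case using assms(1)[of i] step by (auto simp: of_nat_diff)
  qed
  then show "{1..z i} \<subseteq> z ` {i..n}" and "z i \<le> int (n - i) + 1" by auto
qed

text \<open>
  If \<open>z 1 > m\<close> then, depending on the parity of \<open>m\<close>, the odd numbers \<open>1, 3, \<dots>, m + 1\<close> or the even numbers
  \<open>2, 4, \<dots>, m + 1\<close> are all values of \<open>z\<close>; in either case this is one more than the count permits.
\<close>

lemma largest_le_parity_count:
  fixes z :: "nat \<Rightarrow> int"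
  assumes vals: "{1..z 1} \<subseteq> z ` {1..n}"
    and odd: "even m \<Longrightarrow> 2 * card {j \<in> {1..n}. odd (z j)} = m"
    and even: "odd m \<Longrightarrow> 2 * card {j \<in> {1..n}. even (z j)} + 1 = m"
  shows "z 1 \<le> int m"
proof (rule ccontr)
  assume neg: "\<not> z 1 \<le> int m"
  have card_le: "card A \<le> card S" if "f ` A \<subseteq> z ` S" "inj_on f A" "finite S" for f and A :: "int set" and S
    using card_mono[OF finite_imageI[OF that(3)] that(1)] card_image_le[OF that(3), of z] card_image[OF that(2)]
    by simp
  show False
  proof (cases "even m")
    case True
    then obtain h where h: "m = 2 * h" by blast
    have "(\<lambda>t. 2 * t - 1) ` {1..int h + 1} \<subseteq> z ` {j \<in> {1..n}. odd (z j)}"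
    proof
      fix y assume "y \<in> (\<lambda>t. 2 * t - 1) ` {1..int h + 1}"
      then have "odd y" "y \<in> {1..z 1}" using neg h by auto
      moreover from this obtain j where "j \<in> {1..n}" "y = z j" using vals by blast
      ultimately show "y \<in> z ` {j \<in> {1..n}. odd (z j)}" by simp
    qed
    then have "card {1..int h + 1} \<le> card {j \<in> {1..n}. odd (z j)}"
      by (intro card_le) (auto simp: inj_on_def)
    then show False using odd[OF True] h by simp
  next
    case False
    then obtain h where h: "m = 2 * h + 1" by (rule oddE)
    have "(\<lambda>t. 2 * t) ` {1..int h + 1} \<subseteq> z ` {j \<in> {1..n}. even (z j)}"
    proof
      fix y assume "y \<in> (\<lambda>t. 2 * t) ` {1..int h + 1}"
      then have "even y" "y \<in> {1..z 1}" using neg h by auto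
      moreover from this obtain j where "j \<in> {1..n}" "y = z j" using vals by blast
      ultimately show "y \<in> z ` {j \<in> {1..n}. even (z j)}" by simp
    qed
    then have "card {1..int h + 1} \<le> card {j \<in> {1..n}. even (z j)}"
      by (intro card_le) (auto simp: inj_on_def)
    then show False using even[OF False] h by simp
  qed
qed

context adapted
begin

lemma card_idx_lam:
  assumes z: "\<And>j. j \<in> {1..n} \<Longrightarrow> a j = of_int (z j)"
  shows "card {p \<in> idx. exp (\<i> * of_real (pi * lam a p)) = - 1} = 2 * card {j \<in> {1..n}. odd (z j)}"
    and "card {p \<in> idx. exp (\<i> * of_real (pi * lam a p)) = 1} = 2 * card {j \<in> {1..n}. even (z j)} + 1"
proof -
  define f where "f p = exp (\<i> * of_real (pi * lam a p))" for p
  have f: "f j = (if even (z j) then 1 else - 1)" "f (n + j) = (if even (z j) then 1 else - 1)" "f mid = 1"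
    if "j \<in> {1..n}" for j
  proof -
    have "lam a j = of_int (z j)" "lam a (n + j) = of_int (- z j)" using that z by (simp_all add: lam_def)
    then show "f j = (if even (z j) then 1 else - 1)" "f (n + j) = (if even (z j) then 1 else - 1)"
      unfolding f_def by (simp_all only: exp_ipi_int even_minus)
    show "f mid = 1" by (simp add: f_def lam_mid)
  qed
  have idx: "idx = {1..n} \<union> (+) n ` {1..n} \<union> {mid}"
  proof -
    have "p \<in> (+) n ` {1..n}" if "n < p" "p \<le> 2 * n" for p
      using that by (intro image_eqI[of _ _ "p - n"]) auto
    then show ?thesis by (force simp: idx_def mid_def)
  qed
  have split: "{p \<in> idx. f p = c} = {j \<in> {1..n}. f j = c} \<union> (+) n ` {j \<in> {1..n}. f (n + j) = c} \<union>
      (if f mid = c then {mid} else {})" for c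
  proof -
    have "{p \<in> idx. f p = c} = {j \<in> {1..n}. f j = c} \<union> {p \<in> (+) n ` {1..n}. f p = c} \<union> {p \<in> {mid}. f p = c}"
      unfolding idx by blast
    moreover have "{p \<in> (+) n ` {1..n}. f p = c} = (+) n ` {j \<in> {1..n}. f (n + j) = c}" by blast
    moreover have "{p \<in> {mid}. f p = c} = (if f mid = c then {mid} else {})" by auto
    ultimately show ?thesis by (simp only:)
  qed
  have card: "card {p \<in> idx. f p = c} = card {j \<in> {1..n}. f j = c} + card {j \<in> {1..n}. f (n + j) = c} +
      (if f mid = c then 1 else 0)" for c
  proof -
    let ?A = "{j \<in> {1..n}. f j = c}" and ?B = "(+) n ` {j \<in> {1..n}. f (n + j) = c}"
      and ?C = "if f mid = c then {mid} else {}"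
    have "?A \<inter> ?B = {}" by auto
    moreover have "(?A \<union> ?B) \<inter> ?C = {}"
    proof -
      have "x \<noteq> mid" if "x \<in> ?A \<union> ?B" for x using that by (auto simp: mid_def)
      moreover have "x = mid" if "x \<in> ?C" for x using that by (simp split: if_splits)
      ultimately show ?thesis unfolding disjoint_iff by metis
    qed
    moreover have "card ?B = card {j \<in> {1..n}. f (n + j) = c}" by (rule card_image) simp
    ultimately show ?thesis unfolding split by (simp add: card_Un_disjoint)
  qed
  have odd: "{j \<in> {1..n}. f j = - 1} = {j \<in> {1..n}. odd (z j)}" "{j \<in> {1..n}. f (n + j) = - 1} = {j \<in> {1..n}. odd (z j)}"
    and even: "{j \<in> {1..n}. f j = 1} = {j \<in> {1..n}. even (z j)}" "{j \<in> {1..n}. f (n + j) = 1} = {j \<in> {1..n}. even (z j)}"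
    using f by (auto split: if_splits)
  have m: "f mid = 1" by (simp add: f_def lam_mid)
  show "card {p \<in> idx. exp (\<i> * of_real (pi * lam a p)) = - 1} = 2 * card {j \<in> {1..n}. odd (z j)}"
    using card[of "- 1"] unfolding odd m by (simp add: f_def)
  show "card {p \<in> idx. exp (\<i> * of_real (pi * lam a p)) = 1} = 2 * card {j \<in> {1..n}. even (z j)} + 1"
    using card[of 1] unfolding even m by (simp add: f_def)
qed

text \<open>
  The number \<open>m\<close> enters as the dimension of an eigenspace of \<open>exp (\<pi> \<xi>)\<close>, which belongs to the class \<open>N_class \<xi>\<close>.
\<close>

lemma canonical_bounds:
  assumes can: "symmetric_canonical n e (tor a)"
    and N: "N_class (tor a) = iota m ` real_grassmannian m"
    and j: "j \<in> {1..n}"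
  shows "0 \<le> a j" and "a j \<le> real m" and "a j \<le> real n - real j + 1"
proof -
  have dom: "\<And>j. j \<in> {1..n} \<Longrightarrow> a j \<in> \<int> \<and> 0 \<le> a j" "\<And>i j. i \<in> {1..n} \<Longrightarrow> j \<in> {1..n} \<Longrightarrow> i < j \<Longrightarrow> a j \<le> a i"
    using can unfolding symmetric_canonical_def dominant_lattice_tor by auto
  define z where "z j = \<lfloor>a j\<rfloor>" for j
  have z: "a j = of_int (z j)" if "j \<in> {1..n}" for j
    using dom(1)[OF that] by (auto simp: z_def elim: Ints_cases)
  have step: "z j \<le> z (Suc j) + 1" if "1 \<le> j" "j < n" for j
  proof -
    have "of_int (z j) - of_int (z (Suc j)) < (2 :: real)"
      using canonical_jump[OF can, of j] that z[of j] z[of "Suc j"] by simp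
    then show ?thesis by linarith
  qed
  have last: "z n \<le> 1"
  proof -
    have "of_int (z n) < (2 :: real)"
      using canonical_jump[OF can, of n] n_pos z[of n] by simp
    then show ?thesis by linarith
  qed
  obtain W where W: "vec.subspace W" "vec.dim W = m" and g: "mexp (pi *\<^sub>R tor a) = iota m W"
    using gamma_in_N_class[of "tor a"] N unfolding gamma_minus_1 real_grassmannian_def by auto
  have dim: "vec.dim {v. mexp (pi *\<^sub>R tor a) *v v = d *s v} = card {p \<in> idx. exp (\<i> * of_real (pi * lam a p)) = d}" for d
    by (rule dim_eigenspace) (rule mexp_tor)
  have "card {p \<in> idx. exp (\<i> * of_real (pi * lam a p)) = (if even m then - 1 else 1)} = m"
    unfolding dim[symmetric] g iota_eigenspace[OF W(1)] by (rule W(2))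
  then have "even m \<Longrightarrow> 2 * card {j \<in> {1..n}. odd (z j)} = m" "odd m \<Longrightarrow> 2 * card {j \<in> {1..n}. even (z j)} + 1 = m"
    using card_idx_lam[of a z, OF z] by simp_all
  then have "z 1 \<le> int m"
    using descending_values(1)[of n z 1, OF step last] n_pos by (intro largest_le_parity_count[of z n m]) simp_all
  then have "a 1 \<le> real m" using z[of 1] n_pos by simp
  moreover have "a j \<le> a 1" using dom(2)[of 1 j] j by (cases "j = 1") auto
  ultimately show "a j \<le> real m" by simp
  show "0 \<le> a j" using dom(1)[OF j] by simp
  have "z j \<le> int (n - j) + 1"
    using descending_values(2)[of n z j, OF step last] j by simp
  then have "real_of_int (z j) \<le> real_of_int (int (n - j) + 1)" by (simp only: of_int_le_iff)
  then show "a j \<le> real n - real j + 1" using z[OF j] j by (simp add: of_nat_diff)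
qed

end

text \<open>
  The right-hand side is attained when \<open>a\<^sub>j = min m (n - j + 1)\<close>: beyond \<open>n - m + 1\<close> it grows by \<open>2 (n - k)\<close>
  from \<open>k\<close> to \<open>k + 1\<close>, which is twice the bound for \<open>a\<^bsub>k+1\<^esub>\<close>.
\<close>

lemma staircase_sum:
  fixes a :: "nat \<Rightarrow> real"
  assumes m: "\<And>j. j \<in> {1..n} \<Longrightarrow> a j \<le> real m" and stair: "\<And>j. j \<in> {1..n} \<Longrightarrow> a j \<le> real n - real j + 1"
    and "m \<le> n" "k \<le> n" "n - m + 1 \<le> k"
  shows "2 * (\<Sum>j=1..k. a j) \<le> 2 * real m * (real n - real m + 1) +
                   (real k - real n + real m - 1) * (real m + real n - real k)"
  using assms(5,4)
proof (induction k rule: dec_induct)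
  case base
  have "(\<Sum>j=1..n - m + 1. a j) \<le> real (n - m + 1) * real m"
    using sum_bounded_above[of "{1..n - m + 1}" a "real m"] m base by simp
  moreover have q: "real (n - m + 1) = real n - real m + 1" using \<open>m \<le> n\<close> by (simp add: of_nat_diff)
  ultimately show ?case unfolding q by (simp add: mult.commute)
next
  case (step k)
  have "2 * (\<Sum>j=1..Suc k. a j) = 2 * (\<Sum>j=1..k. a j) + 2 * a (Suc k)" by simp
  also have "\<dots> \<le> (2 * real m * (real n - real m + 1) +
      (real k - real n + real m - 1) * (real m + real n - real k)) + 2 * (real n - real k)"
    using step stair[of "Suc k"] by simp
  also have "\<dots> = 2 * real m * (real n - real m + 1) +
      (real (Suc k) - real n + real m - 1) * (real m + real n - real (Suc k))"
    by (simp add: algebra_simps)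
  finally show ?case .
qed

section \<open>The bounds on the uniton numbers\<close>

theorem proposition6p4:
  fixes n m :: nat
    and e :: "nat \<Rightarrow> complex^'d"
    and \<xi> :: "complex^'d^'d"
    and smul :: "complex \<Rightarrow> 'v::ab_group_add \<Rightarrow> 'v"
  assumes "n \<ge> 1"
    and "CARD('d) = 2 * n + 1"
    and "adapted_basis n e"
    and "symmetric_canonical n e \<xi>"
    and "m \<le> n"
    and "N_class \<xi> = iota m ` real_grassmannian m"
  shows "(\<forall>(k::nat) (V :: 'v set) (\<rho> :: complex^'d^'d \<Rightarrow> 'v \<Rightarrow> 'v).
            1 \<le> k \<and> k \<le> n \<and> irreducible_representation smul V \<rho> \<and>
            highest_weight n e smul V \<rho> (fundamental_weight n e k) \<longrightarrow>
              (k \<le> n - m + 1 \<longrightarrow>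
                 uniton_number n e smul V \<rho> \<xi> \<le> 2 * real m * real k) \<and>
              (n - m + 1 < k \<and> k < n \<longrightarrow>
                 uniton_number n e smul V \<rho> \<xi> \<le>
                   2 * real m * (real n - real m + 1) +
                   (real k - real n + real m - 1) * (real m + real n - real k))) \<and>
         uniton_number_standard n e \<xi> \<le> 2 * real m \<and>
         (m < n \<longrightarrow> uniton_number_adjoint n e \<xi> \<le> 4 * real m) \<and>
         (m = n \<longrightarrow> uniton_number_adjoint n e \<xi> \<le> 4 * real m - 2)"
proof -
  interpret adapted n e by unfold_locales (fact assms(1) assms(3))+
  have "\<xi> \<in> torus n e"
    using assms(4) by (simp add: symmetric_canonical_def dominant_lattice_def integer_lattice_def)
  then obtain a where \<xi>: "\<xi> = tor a" by (auto simp: torus_eq)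
  note bounds = canonical_bounds[OF assms(4)[unfolded \<xi>] assms(6)[unfolded \<xi>]]
  show ?thesis
    unfolding \<xi> uniton_number_standard_eq uniton_number_adjoint_eq
  proof (intro conjI allI impI; (elim conjE)?)
    fix k V and \<rho> :: "complex^'d^'d \<Rightarrow> 'v \<Rightarrow> 'v"
    assume k: "1 \<le> k" "k \<le> n" and irr: "irreducible_representation smul V \<rho>"
      and hw: "highest_weight n e smul V \<rho> (fundamental_weight n e k)"
    have u: "uniton_number n e smul V \<rho> (tor a) = (if k < n then 2 * (\<Sum>j=1..k. a j) else (\<Sum>j=1..n. a j))"
      using irr hw by (intro uniton_number_fundamental) (simp add: irreducible_representation_def)
    have sum: "(\<Sum>j=1..k. a j) \<le> real k * real m" "0 \<le> (\<Sum>j=1..k. a j)" 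
      using sum_bounded_above[of "{1..k}" a "real m"] bounds(1,2) k by (auto intro: sum_nonneg)
    have "(\<Sum>j=1..k. a j) \<le> 2 * (real k * real m)" using sum by linarith
    then show "uniton_number n e smul V \<rho> (tor a) \<le> 2 * real m * real k"
      using sum k by (cases "k < n") (auto simp: u mult_ac)
    assume "n - m + 1 < k" "k < n"
    then show "uniton_number n e smul V \<rho> (tor a) \<le> 2 * real m * (real n - real m + 1) +
           (real k - real n + real m - 1) * (real m + real n - real k)"
      unfolding u using staircase_sum[of n a m k] bounds(2,3) assms(5) by simp
  next
    show "2 * a 1 \<le> 2 * real m" using bounds(2)[of 1] assms(1) by simp
    show "2 * (a 1 + (if n = 1 then 0 else a 2)) \<le> 4 * real m"
      using bounds(2)[of 1] bounds(2)[of 2] assms(1) by auto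
    show "2 * (a 1 + (if n = 1 then 0 else a 2)) \<le> 4 * real m - 2" if "m = n"
      using bounds(2)[of 1] bounds(3)[of 2] assms(1) that by auto
  qed
qed

end
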